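(* Let $\alpha,\beta>0$. For a measurable function $f:\mathbb{R}^2\to\mathbb{H}$ consider the following two conditions: (A) $e^{\alpha|\mathbf{x}|^2}f\in L^1(\mathbb{R}^2,\mathbb{H})+L^\infty(\mathbb{R}^2,\mathbb{H})$; (B) for some $\rho$ with $0<\rho<+\infty$, $$\int_{\mathbb{R}^2}\log^+\!\left(\frac{\left|\mathcal{F}\{f\}(\mathbf{y})\,e^{\beta|\mathbf{y}|^2}\right|_Q}{\rho}\right)d\mathbf{y}<\infty .$$ Then: (i) If $\alpha\beta>\pi^2$, every measurable $f$ satisfying (A) and (B) is $0$ almost everywhere. (ii) If $\alpha\beta=\pi^2$, every measurable $f$ satisfying (A) and (B) is of the form $f(\mathbf{x})=C\,e^{-\alpha|\mathbf{x}|^2}$ for almost every $\mathbf{x}\in\mathbb{R}^2$, where $C\in\mathbb{H}$ is a constant quaternion. (iii) If $\alpha\beta<\pi^2$, there exist infinitely many functions satisfying (A) and (B).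
   Context: $\mathbb{H}$ denotes the algebra of real quaternions $q=q_0+\mathbf{i}q_1+\mathbf{j}q_2+\mathbf{k}q_3$ ($q_m\in\mathbb{R}$), with $\mathbf{i}^2=\mathbf{j}^2=\mathbf{k}^2=-1$, $\mathbf{i}\mathbf{j}=-\mathbf{j}\mathbf{i}=\mathbf{k}$, $\mathbf{j}\mathbf{k}=-\mathbf{k}\mathbf{j}=\mathbf{i}$, $\mathbf{k}\mathbf{i}=-\mathbf{i}\mathbf{k}=\mathbf{j}$, and modulus $|q|_Q=\sqrt{q_0^2+q_1^2+q_2^2+q_3^2}$. For $\mathbf{x}=(x_1,x_2)\in\mathbb{R}^2$, $|\mathbf{x}|=\sqrt{x_1^2+x_2^2}$, and $d\mathbf{x}$ is Lebesgue measure on $\mathbb{R}^2$. For $1\le p\le\infty$, $L^p(\mathbb{R}^2,\mathbb{H})$ is the space of measurable $f:\mathbb{R}^2\to\mathbb{H}$ with $|f|_Q\in L^p(\mathbb{R}^2)$. $L^1(\mathbb{R}^2,\mathbb{H})+L^\infty(\mathbb{R}^2,\mathbb{H})$ is the set of functions $f_1+f_2$ with $f_1\in L^1(\mathbb{R}^2,\mathbb{H})$ and $f_2\in L^\infty(\mathbb{R}^2,\mathbb{H})$. The two-sided quaternion Fourier transform of $f\in L^1(\mathbb{R}^2,\mathbb{H})$ is $$\mathcal{F}\{f\}(\boldsymbol{\xi})=\int_{\mathbb{R}^2}e^{-\mathbf{i}2\pi\xi_1x_1}\,f(\mathbf{x})\,e^{-\mathbf{j}2\pi\xi_2x_2}\,d\mathbf{x},\qquad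 \boldsymbol{\xi}=(\xi_1,\xi_2)\in\mathbb{R}^2 .$$ (Condition (A) implies $f\in L^1(\mathbb{R}^2,\mathbb{H})$, so that $\mathcal{F}\{f\}$ is defined.) $\log^+(x)=\log x$ if $x>1$ and $\log^+(x)=0$ otherwise. *)

theory Defs
  imports "HOL-Analysis.Analysis"
begin

section \<open>The real quaternions\<close>

datatype quat = Quat (re_part: real) (i_part: real) (j_part: real) (k_part: real)

lemma quat_eq_iff:
  "p = q \<longleftrightarrow> re_part p = re_part q \<and> i_part p = i_part q \<and>
     j_part p = j_part q \<and> k_part p = k_part q"
  by (cases p; cases q) auto

instantiation quat :: ring_1
begin

definition "0 = Quat 0 0 0 0"
definition "1 = Quat 1 0 0 0"
definition "- p = Quat (- re_part p) (- i_part p) (- j_part p) (- k_part p)"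
definition "p + q = Quat (re_part p + re_part q) (i_part p + i_part q)
                         (j_part p + j_part q) (k_part p + k_part q)"
definition "p - q = Quat (re_part p - re_part q) (i_part p - i_part q)
                         (j_part p - j_part q) (k_part p - k_part q)"
definition "p * q = Quat
  (re_part p * re_part q - i_part p * i_part q - j_part p * j_part q - k_part p * k_part q)
  (re_part p * i_part q + i_part p * re_part q + j_part p * k_part q - k_part p * j_part q)
  (re_part p * j_part q - i_part p * k_part q + j_part p * re_part q + k_part p * i_part q)
  (re_part p * k_part q + i_part p * j_part q - j_part p * i_part q + k_part p * re_part q)"

instance
  by standard
    (auto simp: zero_quat_def one_quat_def uminus_quat_def plus_quat_def minus_quat_def
       times_quat_def algebra_simps)

end

instantiation quat :: real_vector
begin

definition "r *\<^sub>R q = Quat (r * re_part q) (r * i_part q) (r * j_part q) (r * k_part q)"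

instance
  by standard (auto simp: scaleR_quat_def plus_quat_def algebra_simps)

end

instantiation quat :: real_inner
begin

definition "p \<bullet> q = re_part p * re_part q + i_part p * i_part q
                  + j_part p * j_part q + k_part p * k_part q"
definition "norm q = sqrt ((re_part q)\<^sup>2 + (i_part q)\<^sup>2 + (j_part q)\<^sup>2 + (k_part q)\<^sup>2)"
definition "sgn q = q /\<^sub>R norm q" for q :: quat
definition "dist p q = norm (p - q)" for p q :: quat
definition uniformity_quat :: "(quat \<times> quat) filter"
  where "uniformity_quat = (INF e\<in>{0<..}. principal {(p, q). dist p q < e})"
definition open_quat :: "quat set \<Rightarrow> bool"
  where "open_quat U \<longleftrightarrow> (\<forall>p\<in>U. eventually (\<lambda>(p', q). p' = p \<longrightarrow> q \<in> U) uniformity)"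

instance
proof
  fix p q r :: quat and a :: real
  show "p \<bullet> q = q \<bullet> p" "(p + q) \<bullet> r = p \<bullet> r + q \<bullet> r" "(a *\<^sub>R p) \<bullet> q = a * (p \<bullet> q)"
    by (auto simp: inner_quat_def scaleR_quat_def plus_quat_def algebra_simps)
  show "0 \<le> p \<bullet> p"
    by (simp add: inner_quat_def)
  show "p \<bullet> p = 0 \<longleftrightarrow> p = 0"
  proof
    assume "p \<bullet> p = 0"
    then have "(re_part p)\<^sup>2 + (i_part p)\<^sup>2 + (j_part p)\<^sup>2 + (k_part p)\<^sup>2 = 0"
      by (simp add: inner_quat_def power2_eq_square)
    then have "re_part p = 0 \<and> i_part p = 0 \<and> j_part p = 0 \<and> k_part p = 0"
      by (simp add: add_nonneg_eq_0_iff)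
    then show "p = 0"
      by (simp add: quat_eq_iff zero_quat_def)
  qed (simp add: inner_quat_def zero_quat_def)
  show "norm p = sqrt (p \<bullet> p)"
    by (simp add: norm_quat_def inner_quat_def power2_eq_square)
qed (simp_all add: sgn_quat_def dist_quat_def uniformity_quat_def open_quat_def)

end

instantiation quat :: real_normed_div_algebra
begin

definition "inverse q = Quat (re_part q) (- i_part q) (- j_part q) (- k_part q) /\<^sub>R (norm q)\<^sup>2"
definition "p div q = p * inverse q" for p q :: quat

instance
proof
  fix p q :: quat
  show scale: "a *\<^sub>R p * q = a *\<^sub>R (p * q)" "p * a *\<^sub>R q = a *\<^sub>R (p * q)"
    for a and p q :: quat
    by (auto simp: scaleR_quat_def times_quat_def algebra_simps)
  have "(re_part (p * q))\<^sup>2 + (i_part (p * q))\<^sup>2 + (j_part (p * q))\<^sup>2 + (k_part (p * q))\<^sup>2 =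
      ((re_part p)\<^sup>2 + (i_part p)\<^sup>2 + (j_part p)\<^sup>2 + (k_part p)\<^sup>2) *
      ((re_part q)\<^sup>2 + (i_part q)\<^sup>2 + (j_part q)\<^sup>2 + (k_part q)\<^sup>2)"
    unfolding times_quat_def quat.sel by algebra
  then show "norm (p * q) = norm p * norm q"
    by (simp only: norm_quat_def real_sqrt_mult)
  let ?c = "Quat (re_part q) (- i_part q) (- j_part q) (- k_part q)"
  have n: "(norm q)\<^sup>2 = (re_part q)\<^sup>2 + (i_part q)\<^sup>2 + (j_part q)\<^sup>2 + (k_part q)\<^sup>2"
    by (simp add: norm_quat_def)
  have "?c * q = (norm q)\<^sup>2 *\<^sub>R 1" "q * ?c = (norm q)\<^sup>2 *\<^sub>R 1"
    unfolding n by (simp_all add: times_quat_def scaleR_quat_def one_quat_def power2_eq_square)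
  moreover have "inverse q * q = inverse ((norm q)\<^sup>2) *\<^sub>R (?c * q)"
    "q * inverse q = inverse ((norm q)\<^sup>2) *\<^sub>R (q * ?c)"
    by (simp_all only: inverse_quat_def scale)
  ultimately show "inverse q * q = 1" "q * inverse q = 1" if "q \<noteq> 0"
    using that by simp_all
  show "p div q = p * inverse q"
    by (rule divide_quat_def)
  show "inverse (0 :: quat) = 0"
    by (simp add: inverse_quat_def scaleR_quat_def zero_quat_def)
qed

end

definition qi :: quat where "qi = Quat 0 1 0 0"
definition qj :: quat where "qj = Quat 0 0 1 0"
definition qk :: quat where "qk = Quat 0 0 0 1"

lemma quat_unit_mult:
  "qi * qi = -1" "qj * qj = -1" "qk * qk = -1"
  "qi * qj = qk" "qj * qi = - qk" "qj * qk = qi" "qk * qj = - qi" "qk * qi = qj" "qi * qk = - qj"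
  by (simp_all add: qi_def qj_def qk_def times_quat_def one_quat_def uminus_quat_def)

lemma quat_expand:
  "Quat a b c d = of_real a + b *\<^sub>R qi + c *\<^sub>R qj + d *\<^sub>R qk"
  by (simp add: qi_def qj_def qk_def of_real_def scaleR_quat_def plus_quat_def one_quat_def)

(* Gives completeness and second countability, hence exp, the Bochner integral and the
   Borel structure on quat. *)
instantiation quat :: euclidean_space
begin

definition "Basis = {1, qi, qj, qk}"

instance
proof
  fix u v :: quat
  show "(Basis :: quat set) \<noteq> {}" "finite (Basis :: quat set)"
    by (simp_all add: Basis_quat_def)
  show "u \<bullet> v = (if u = v then 1 else 0)" if "u \<in> Basis" "v \<in> Basis"
    using that unfolding Basis_quat_def one_quat_def qi_def qj_def qk_def
    by (elim insertE emptyE) (simp_all add: inner_quat_def)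
  have "(\<forall>v\<in>Basis. u \<bullet> v = 0) \<longleftrightarrow>
      re_part u = 0 \<and> i_part u = 0 \<and> j_part u = 0 \<and> k_part u = 0"
    unfolding Basis_quat_def one_quat_def qi_def qj_def qk_def by (simp add: inner_quat_def)
  then show "(\<forall>v\<in>Basis. u \<bullet> v = 0) \<longleftrightarrow> u = 0"
    by (simp add: quat_eq_iff zero_quat_def)
qed

end

section \<open>Function spaces, Fourier transform and the two conditions\<close>

(* The plane is real \<times> real, whose norm is the Euclidean one; "measurable" means Lebesgue
   measurable, so membership in the spaces below is invariant under changes on null sets. *)

definition L1_quat :: "(real \<times> real \<Rightarrow> quat) set" where
  "L1_quat = {f \<in> borel_measurable lebesgue. integrable lebesgue (\<lambda>x. norm (f x))}"

definition Linf_quat :: "(real \<times> real \<Rightarrow> quat) set" where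
  "Linf_quat = {f \<in> borel_measurable lebesgue. \<exists>M. AE x in lebesgue. norm (f x) \<le> M}"

definition L1_plus_Linf_quat :: "(real \<times> real \<Rightarrow> quat) set" where
  "L1_plus_Linf_quat = {(\<lambda>x. f1 x + f2 x) | f1 f2. f1 \<in> L1_quat \<and> f2 \<in> Linf_quat}"

definition qft :: "(real \<times> real \<Rightarrow> quat) \<Rightarrow> real \<times> real \<Rightarrow> quat" where
  "qft f \<xi> = (\<integral>x. exp (- ((2 * pi * fst \<xi> * fst x) *\<^sub>R qi)) * f x
                   * exp (- ((2 * pi * snd \<xi> * snd x) *\<^sub>R qj)) \<partial>lebesgue)"

definition log_plus :: "real \<Rightarrow> real" where
  "log_plus x = (if x > 1 then ln x else 0)"

definition condition_A :: "real \<Rightarrow> (real \<times> real \<Rightarrow> quat) \<Rightarrow> bool" where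
  "condition_A \<alpha> f \<longleftrightarrow> (\<lambda>x. exp (\<alpha> * (norm x)\<^sup>2) *\<^sub>R f x) \<in> L1_plus_Linf_quat"

definition condition_B :: "real \<Rightarrow> (real \<times> real \<Rightarrow> quat) \<Rightarrow> bool" where
  "condition_B \<beta> f \<longleftrightarrow> (\<exists>\<rho>>0.
     (\<integral>\<^sup>+ y. ennreal (log_plus (norm (exp (\<beta> * (norm y)\<^sup>2) *\<^sub>R qft f y) / \<rho>)) \<partial>lebesgue) < \<infinity>)"

end

theory Submission
  imports Defs "HOL-Complex_Analysis.Complex_Analysis" "HOL-Probability.Probability"
begin

text \<open>
  By condition (A), each complex component of the transform, as a function of one frequency alone,
  extends to an entire function; multiplied by \<open>exp (\<beta> z^2)\<close> it becomes an entire \<open>g\<close> with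
  \<open>|g z| \<le> C exp (\<beta> (Re z)^2)\<close>, and by condition (B) and Fubini \<open>log_plus |g|\<close> is integrable on the
  real line for almost every value of the other frequency. Such a \<open>g\<close> is constant: averaging
  \<open>ln (1 + |g|)\<close> over unit-scale horizontal shifts gives a subharmonic function that is bounded on the
  real axis and on vertical strips, hence in every quadrant by a Phragmen-Lindelof argument, and the
  mean value inequality on discs then bounds \<open>g\<close> itself. So the transform is a Gaussian when
  \<open>\<alpha> \<beta> = pi^2\<close>, and injectivity gives (ii). For \<open>\<alpha> \<beta> > pi^2\<close> the conditions may be weakened to the
  critical case in two ways, and the two resulting Gaussians of different widths must both vanish.
\<close>

section \<open>Entire functions with integrable positive logarithm on the real line\<close>

text \<open>Order two is the critical order for a quadrant: \<open>x y\<close> is harmonic, vanishes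
  on both axes and grows quadratically. It is excluded because the growth bound involves
  \<open>Re z\<close> alone: close to the imaginary axis \<open>b x^2\<close> falls below any fixed
  positive multiple of \<open>x y\<close>. That form of the bound comes from an exact cancellation.
  Completing the square under (A) gives the continued transform the growth
  \<open>exp (b (Im z)^2)\<close> with \<open>b = pi^2 / a\<close>, and
  \<open>|exp (b z^2)| = exp (b (Re z)^2 - b (Im z)^2)\<close> removes it. Averaging is forced by
  (B), which controls an integral over the line but no single value on it. The frequencies are
  continued separately because their kernels are scalars for different complex structures on the
  quaternions: left multiplication by \<open>i\<close> and right multiplication by
  \<open>j\<close>.\<close>

lemma riemann_sum_error:
  fixes l :: "real \<Rightarrow> real"
  assumes cont: "continuous_on {0..1} l" and n: "n > 0"
    and osc: "\<And>s t. s \<in> {0..1} \<Longrightarrow> t \<in> {0..1} \<Longrightarrow> \<bar>s - t\<bar> \<le> 1 / real n \<Longrightarrow> \<bar>l s - l t\<bar> \<le> e"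
  shows "\<bar>integral {0..1} l - (\<Sum>k<n. l (real k / real n)) / real n\<bar> \<le> e"
proof -
  have "\<bar>integral {0..real m / real n} l - (\<Sum>k<m. l (real k / real n)) / real n\<bar> \<le> real m / real n * e"
    if "m \<le> n" for m
    using that
  proof (induction m)
    case (Suc m)
    let ?a = "real m / real n" and ?b = "real (Suc m) / real n"
    have ab: "0 \<le> ?a" "?a \<le> ?b" "?b \<le> 1" "?b - ?a = 1 / real n"
      using n Suc.prems by (auto simp: divide_simps)
    have int: "l integrable_on {c..d}" if "0 \<le> c" "d \<le> 1" for c d
      using that by (intro integrable_continuous_real continuous_on_subset[OF cont]) auto
    have split: "integral {0..?b} l = integral {0..?a} l + integral {?a..?b} l"
      using ab int by (intro Henstock_Kurzweil_Integration.integral_combine[symmetric]) auto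
    have "integral {?a..?b} (\<lambda>t. l t - l ?a) = integral {?a..?b} l - 1 / real n * l ?a"
      using ab int by (subst Henstock_Kurzweil_Integration.integral_diff) auto
    moreover have "norm (integral {?a..?b} (\<lambda>t. l t - l ?a)) \<le> e * (?b - ?a)"
    proof (rule integral_bound)
      show "continuous_on {?a..?b} (\<lambda>t. l t - l ?a)"
        using ab by (intro continuous_intros continuous_on_subset[OF cont]) auto
      show "norm (l t - l ?a) \<le> e" if "t \<in> {?a..?b}" for t
      proof -
        have "t \<in> {0..1}" "?a \<in> {0..1}" "\<bar>t - ?a\<bar> \<le> 1 / real n"
          using that ab unfolding atLeastAtMost_iff by linarith+
        then show ?thesis using osc by simp
      qed
    qed (use ab in auto)
    ultimately have "\<bar>integral {?a..?b} l - l ?a / real n\<bar> \<le> e / real n"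
      using ab by simp
    with Suc.IH Suc.prems split show ?case
      by (simp add: add_divide_distrib algebra_simps)
  qed simp
  from this[of n] n show ?thesis by simp
qed

text \<open>
  The integral of \<open>ln (1 + |h t z|)\<close> over \<open>t\<close> is subharmonic in \<open>z\<close>. Instead of invoking potential
  theory we apply the maximum modulus principle to the product of the functions
  \<open>c k + h (k / n)\<close>, where the phases \<open>c k\<close> make the triangle inequality sharp at the point of interest.
\<close>

lemma max_principle_integral_ln:
  fixes h :: "real \<Rightarrow> complex \<Rightarrow> complex"
  assumes hol: "\<And>t. h t holomorphic_on UNIV"
    and cont: "continuous_on UNIV (\<lambda>(t, z). h t z)"
    and K: "compact K" and holq: "q holomorphic_on interior K" and contq: "continuous_on K q"
    and B: "\<And>z. z \<in> frontier K \<Longrightarrow> integral {0..1} (\<lambda>t. ln (1 + norm (h t z))) + Re (q z) \<le> B"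
    and z0: "z0 \<in> K"
  shows "integral {0..1} (\<lambda>t. ln (1 + norm (h t z0))) + Re (q z0) \<le> B"
proof (rule field_le_epsilon)
  fix e :: real assume e: "e > 0"
  define l where "l = (\<lambda>(t, z). ln (1 + norm (h t z)))"
  have contl: "continuous_on UNIV l"
    unfolding l_def case_prod_beta using cont[unfolded case_prod_beta]
    by (intro continuous_intros) (auto intro: add_pos_nonneg simp: add_nonneg_eq_0_iff)
  \<comment> \<open>Joint uniform continuity yields one mesh \<open>1 / n\<close> for all
    \<open>z\<close> in \<open>K\<close>. The same finite product must serve at \<open>z0\<close>
    and on the whole frontier.\<close>
  have "uniformly_continuous_on ({0..1} \<times> K) l"
    by (rule compact_uniformly_continuous) (use K contl in \<open>auto intro: continuous_on_subset compact_Times\<close>)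
  then obtain d where d: "d > 0"
    and ld: "\<And>p p'. p \<in> {0..1} \<times> K \<Longrightarrow> p' \<in> {0..1} \<times> K \<Longrightarrow> dist p' p < d \<Longrightarrow> dist (l p') (l p) < e / 2"
    using e unfolding uniformly_continuous_on_def by (metis half_gt_zero)
  obtain n :: nat where n: "n > 0" "1 / real n < d"
    using d by (metis nat_approx_posE zero_less_Suc)
  let ?S = "\<lambda>z. \<Sum>k<n. l (real k / real n, z)"
  have riem: "\<bar>integral {0..1} (\<lambda>t. ln (1 + norm (h t z))) - ?S z / real n\<bar> \<le> e / 2" if "z \<in> K" for z
  proof -
    have "\<bar>integral {0..1} (\<lambda>t. l (t, z)) - ?S z / real n\<bar> \<le> e / 2"
    proof (rule riemann_sum_error)
      show "continuous_on {0..1} (\<lambda>t. l (t, z))"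
        by (rule continuous_on_compose2[OF contl]) (auto intro!: continuous_intros)
      show "\<bar>l (s, z) - l (t, z)\<bar> \<le> e / 2"
        if "s \<in> {0..1}" "t \<in> {0..1}" "\<bar>s - t\<bar> \<le> 1 / real n" for s t
        using ld[of "(t, z)" "(s, z)"] that n \<open>z \<in> K\<close> by (simp add: dist_Pair_Pair dist_real_def)
    qed (use n in auto)
    then show ?thesis by (simp add: l_def)
  qed
  \<comment> \<open>Where \<open>h\<close> vanishes at \<open>z0\<close> any unit number would do;
    \<open>1\<close> is the default.\<close>
  define c where "c k = (if h (real k / real n) z0 = 0 then 1 else sgn (h (real k / real n) z0))" for k
  have c1: "norm (c k) = 1" for k
    by (simp add: c_def norm_sgn)
  have c2: "norm (c k + h (real k / real n) z0) = 1 + norm (h (real k / real n) z0)" for k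
  proof (cases "h (real k / real n) z0 = 0")
    case False
    let ?w = "h (real k / real n) z0"
    have "c k + ?w = of_real (1 + norm ?w) * sgn ?w"
      using False by (simp add: c_def sgn_eq field_simps)
    then show ?thesis
      using False by (simp only: norm_mult norm_of_real) (simp add: norm_sgn)
  qed (simp add: c_def)
  \<comment> \<open>\<open>ln |G| / n\<close> is at most the Riemann sum plus \<open>Re q\<close>,
    with equality at \<open>z0\<close>. The exponent is \<open>n q\<close> because the Riemann sum
    is divided by \<open>n\<close>.\<close>
  define G where "G z = (\<Prod>k<n. c k + h (real k / real n) z) * exp (of_nat n * q z)" for z
  have expS: "exp (?S z) = (\<Prod>k<n. 1 + norm (h (real k / real n) z))" for z
    by (simp add: l_def exp_sum add_pos_nonneg)
  have Gle: "norm (G z) \<le> exp (?S z + real n * Re (q z))" for z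
  proof -
    have "norm (G z) = (\<Prod>k<n. norm (c k + h (real k / real n) z)) * exp (real n * Re (q z))"
      by (simp add: G_def norm_mult prod_norm)
    also have "\<dots> \<le> (\<Prod>k<n. 1 + norm (h (real k / real n) z)) * exp (real n * Re (q z))"
      by (intro mult_right_mono prod_mono) (auto intro: order.trans[OF norm_triangle_ineq] simp: c1)
    finally show ?thesis by (simp only: exp_add expS)
  qed
  have G0: "norm (G z0) = exp (?S z0 + real n * Re (q z0))"
    by (simp add: G_def norm_mult flip: prod_norm) (simp only: exp_add expS c2)
  have "norm (G z0) \<le> exp (real n * (B + e / 2))"
  proof (rule maximum_modulus_frontier[where f = G and S = K])
    show "G holomorphic_on interior K"
      unfolding G_def by (intro holomorphic_intros holq) (auto intro: holomorphic_on_subset[OF hol])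
    have "continuous_on K (h t)" for t
      using hol holomorphic_on_imp_continuous_on holomorphic_on_subset by blast
    then show "continuous_on (closure K) G"
      unfolding G_def using K by (simp add: compact_imp_closed) (intro continuous_intros contq)
    show "bounded K" using K by (rule compact_imp_bounded)
    show "norm (G z) \<le> exp (real n * (B + e / 2))" if "z \<in> frontier K" for z
    proof -
      have "z \<in> K" using that K by (simp add: frontier_def compact_imp_closed)
      from riem[OF this] B[OF that] have "?S z / real n + Re (q z) \<le> B + e / 2" by linarith
      then have "?S z + real n * Re (q z) \<le> real n * (B + e / 2)"
        using n by (simp add: field_simps)
      with Gle[of z] show ?thesis by (meson exp_le_cancel_iff order.trans)
    qed
  qed (fact z0)
  then have "?S z0 / real n + Re (q z0) \<le> B + e / 2"
    using n by (simp add: G0 field_simps)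
  with riem[OF z0] show "integral {0..1} (\<lambda>t. ln (1 + norm (h t z0))) + Re (q z0) \<le> B + e"
    by linarith
qed

section \<open>Horizontal averages and the Phragmen-Lindelof argument\<close>

text \<open>The mean over the horizontal window \<open>[z - 1, z + 1]\<close>, parametrised by
  \<open>[0, 1]\<close>. The integrand \<open>ln (1 + |g|)\<close> replaces
  \<open>log_plus |g|\<close>: the two differ by at most \<open>ln 2\<close>, and
  \<open>1 + |g|\<close> is the maximum of \<open>|c + g|\<close> over unit numbers
  \<open>c\<close>, which is what the product argument exploits.\<close>

definition shift_avg :: "(complex \<Rightarrow> complex) \<Rightarrow> complex \<Rightarrow> real" where
  "shift_avg g z = integral {0..1} (\<lambda>t. ln (1 + norm (g (z + of_real (2 * t - 1)))))"

lemma holomorphic_compose_UNIV: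
  assumes "g holomorphic_on UNIV" "f holomorphic_on S"
  shows "(\<lambda>z. g (f z)) holomorphic_on S"
  using holomorphic_on_compose_gen[OF assms(2,1)] by (simp add: o_def)

text \<open>Serves to remove the two small parameters of the Phragmen-Lindelof argument, each of
  which is admissible only below a bound \<open>d\<close>.\<close>

lemma le_if_le_add_small:
  fixes a m k d :: real
  assumes "d > 0" and le: "\<And>\<delta>. 0 < \<delta> \<Longrightarrow> \<delta> \<le> d \<Longrightarrow> a \<le> m + \<delta> * k"
  shows "a \<le> m"
proof (rule ccontr)
  assume "\<not> a \<le> m"
  \<comment> \<open>\<open>\<bar>k\<bar> + 1\<close> keeps the denominator positive for every sign
    of \<open>k\<close>; this \<open>\<delta>\<close> consumes at most half of the gap
    \<open>a - m\<close>.\<close>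
  define \<delta> where "\<delta> = min d ((a - m) / (2 * (\<bar>k\<bar> + 1)))"
  have \<delta>: "0 < \<delta>" "\<delta> \<le> d" "\<delta> \<le> (a - m) / (2 * (\<bar>k\<bar> + 1))"
    using \<open>\<not> a \<le> m\<close> \<open>d > 0\<close> by (auto simp: \<delta>_def)
  have "\<delta> * k \<le> \<delta> * (\<bar>k\<bar> + 1)"
    using \<delta> by (intro mult_left_mono) auto
  also have "\<dots> \<le> (a - m) / (2 * (\<bar>k\<bar> + 1)) * (\<bar>k\<bar> + 1)"
    using \<delta> by (intro mult_right_mono) auto
  also have "\<dots> = (a - m) / 2" by (simp add: field_simps)
  finally show False using le[OF \<delta>(1,2)] \<open>\<not> a \<le> m\<close> by (simp add: field_simps)
qed

text \<open>
  The barrier for the Phragmen-Lindelof argument: on the sector \<open>0 \<le> y \<le> s x\<close> the rotation by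
  \<open>1 + i \<tau>\<close> moves the sector into the open first quadrant, where \<open>Im (w^2)\<close> dominates \<open>|w|^2\<close>, and the
  logarithm makes the barrier grow faster than quadratically.
\<close>

lemma sector_barrier:
  fixes s :: real and z :: complex
  assumes s: "s \<ge> 1" and z: "0 \<le> Im z" "Im z \<le> s * Re z"
  defines "w \<equiv> Complex 1 (1 / (4 * s)) * z"
  shows "Re w \<ge> 0"
    and "norm z \<le> norm (w + 1)" "1 \<le> norm (w + 1)"
    and "(norm z)\<^sup>2 * (ln (norm (w + 1)) / (2 * s) - 2 * pi) \<le> Im (w\<^sup>2 * Ln (w + 1))"
    and "- (2 * pi * exp (8 * pi * s)) \<le> Im (w\<^sup>2 * Ln (w + 1))"
proof -
  define x y \<tau> where "x = Re z" and "y = Im z" and "\<tau> = 1 / (4 * s)"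
  have xy: "0 \<le> y" "y \<le> s * x" using z by (auto simp: x_def y_def)
  have \<tau>: "0 < \<tau>" "\<tau> \<le> 1 / 4" "\<tau> * s = 1 / 4" using s by (auto simp: \<tau>_def field_simps)
  have "0 \<le> s * x" using xy by linarith
  then have x: "0 \<le> x" using s by (simp add: zero_le_mult_iff)
  have Rew: "Re w = x - \<tau> * y" and Imw: "Im w = y + \<tau> * x"
    by (simp_all add: w_def x_def y_def \<tau>_def)
  have "\<tau> * y \<le> \<tau> * (s * x)" using \<tau> xy by (intro mult_left_mono) auto
  also have "\<dots> = x / 4" using \<tau>(3) by (simp flip: mult.assoc)
  finally show Rew0: "Re w \<ge> 0" using Rew x by linarith
  have nz: "(norm z)\<^sup>2 = x\<^sup>2 + y\<^sup>2" by (simp add: cmod_power2 x_def y_def)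
  have nw: "(norm w)\<^sup>2 = (1 + \<tau>\<^sup>2) * (norm z)\<^sup>2"
    unfolding cmod_power2 Rew Imw by (simp add: x_def y_def power2_eq_square algebra_simps)
  have \<tau>2: "\<tau>\<^sup>2 \<le> 1 / 4" using \<tau> power_mono[of \<tau> "1/4" 2] by (simp add: power2_eq_square)
  have nw1: "(norm (w + 1))\<^sup>2 = (norm w)\<^sup>2 + 2 * Re w + 1"
    unfolding cmod_power2 by (simp add: power2_eq_square algebra_simps)
  have "(norm z)\<^sup>2 \<le> (norm w)\<^sup>2" unfolding nw by (simp add: algebra_simps)
  also have "\<dots> \<le> (norm (w + 1))\<^sup>2" unfolding nw1 using Rew0 by simp
  finally show zw: "norm z \<le> norm (w + 1)" by (rule power2_le_imp_le) simp
  have "1\<^sup>2 \<le> (norm (w + 1))\<^sup>2" unfolding nw1 using Rew0 by simp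
  then show w1: "1 \<le> norm (w + 1)" by (rule power2_le_imp_le) simp
  have ln0: "0 \<le> ln (norm (w + 1))" using w1 by simp
  \<comment> \<open>After the rotation the \<open>x y\<close> term has a coefficient of at least 1,
    since \<open>\<tau>^2 \<le> 1/4\<close>. As \<open>y \<le> s x\<close> and
    \<open>\<tau> s = 1/4\<close>, it dominates \<open>4 \<tau> y^2\<close>: half of this absorbs
    the negative term, the other half completes \<open>2 \<tau> (x^2 + y^2)\<close>.\<close>
  have "Im (w\<^sup>2) = 2 * (x - \<tau> * y) * (y + \<tau> * x)"
    by (simp add: power2_eq_square Rew Imw)
  also have "\<dots> = 2 * (1 - \<tau>\<^sup>2) * (x * y) + 2 * \<tau> * x\<^sup>2 - 2 * \<tau> * y\<^sup>2"
    by (simp add: power2_eq_square algebra_simps)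
  also have "\<dots> \<ge> 1 * (x * y) + 2 * \<tau> * x\<^sup>2 - 2 * \<tau> * y\<^sup>2"
    using \<tau>2 \<tau>(1) x xy by (intro diff_mono add_mono mult_right_mono) auto
  finally have A: "Im (w\<^sup>2) \<ge> x * y + 2 * \<tau> * x\<^sup>2 - 2 * \<tau> * y\<^sup>2" by simp
  have "y * y \<le> (s * x) * y" using xy by (intro mult_right_mono) auto
  then have "4 * \<tau> * (y * y) \<le> 4 * \<tau> * ((s * x) * y)" using \<tau> by (intro mult_left_mono) auto
  also have "\<dots> = 4 * (\<tau> * s) * (x * y)" by simp
  also have "\<dots> = x * y" by (simp only: \<tau>(3))
  finally have "4 * \<tau> * y\<^sup>2 \<le> x * y" by (simp add: power2_eq_square)
  with A have "Im (w\<^sup>2) \<ge> 2 * \<tau> * (x\<^sup>2 + y\<^sup>2)" by (simp add: algebra_simps)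
  then have Imw2: "Im (w\<^sup>2) \<ge> (norm z)\<^sup>2 / (2 * s)"
    by (simp add: nz \<tau>_def)
  have w0: "w + 1 \<noteq> 0" using w1 by auto
  then have ReLn: "Re (Ln (w + 1)) = ln (norm (w + 1))" by (rule Re_Ln)
  have ImLn: "\<bar>Im (Ln (w + 1))\<bar> \<le> pi"
    using mpi_less_Im_Ln[OF w0] Im_Ln_le_pi[OF w0] by linarith
  \<comment> \<open>The argument of the logarithm contributes an error of size
    \<open>|w|^2 pi\<close>; with \<open>|w|^2 \<le> 2 |z|^2\<close> this is the source of the
    \<open>2 * pi\<close> in the lower bound.\<close>
  have "\<bar>Re (w\<^sup>2) * Im (Ln (w + 1))\<bar> \<le> (norm w)\<^sup>2 * pi"
    unfolding abs_mult using abs_Re_le_cmod[of "w\<^sup>2"] ImLn by (intro mult_mono) (auto simp: norm_power)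
  also have "\<dots> \<le> 2 * (norm z)\<^sup>2 * pi"
    unfolding nw using \<tau>2 by (intro mult_right_mono) auto
  finally have B: "\<bar>Re (w\<^sup>2) * Im (Ln (w + 1))\<bar> \<le> 2 * (norm z)\<^sup>2 * pi" .
  have "Im (w\<^sup>2 * Ln (w + 1)) = Re (w\<^sup>2) * Im (Ln (w + 1)) + Im (w\<^sup>2) * ln (norm (w + 1))"
    by (simp only: times_complex.sel ReLn)
  moreover have "(norm z)\<^sup>2 / (2 * s) * ln (norm (w + 1)) \<le> Im (w\<^sup>2) * ln (norm (w + 1))"
    using Imw2 ln0 by (intro mult_right_mono)
  moreover have "(norm z)\<^sup>2 * (ln (norm (w + 1)) / (2 * s) - 2 * pi)
      = (norm z)\<^sup>2 / (2 * s) * ln (norm (w + 1)) - 2 * (norm z)\<^sup>2 * pi"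
    by (simp add: right_diff_distrib)
  ultimately show E: "(norm z)\<^sup>2 * (ln (norm (w + 1)) / (2 * s) - 2 * pi) \<le> Im (w\<^sup>2 * Ln (w + 1))"
    using B by linarith
  \<comment> \<open>Once the logarithm exceeds \<open>4 pi s\<close> the previous bound is
    nonnegative. Otherwise \<open>|z| \<le> exp (4 pi s)\<close>, and the loss is at most
    \<open>2 pi |z|^2\<close>.\<close>
  show "- (2 * pi * exp (8 * pi * s)) \<le> Im (w\<^sup>2 * Ln (w + 1))"
  proof (cases "ln (norm (w + 1)) \<ge> 4 * pi * s")
    case True
    then have "ln (norm (w + 1)) / (2 * s) - 2 * pi \<ge> 0" using s by (simp add: field_simps)
    then have "0 \<le> (norm z)\<^sup>2 * (ln (norm (w + 1)) / (2 * s) - 2 * pi)" by simp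
    moreover have "- (2 * pi * exp (8 * pi * s)) \<le> 0" by simp
    ultimately show ?thesis using E by linarith
  next
    case False
    then have "norm (w + 1) \<le> exp (4 * pi * s)"
      using w1 by (metis exp_le_cancel_iff exp_ln linear not_one_le_zero order_less_le_trans zero_less_one)
    then have "(norm z)\<^sup>2 \<le> (exp (4 * pi * s))\<^sup>2"
      using zw by (intro power_mono) auto
    also have "\<dots> = exp (8 * pi * s)" by (simp flip: exp_double)
    finally have "(norm z)\<^sup>2 * (- 2 * pi) \<ge> exp (8 * pi * s) * (- 2 * pi)"
      by (intro mult_right_mono_neg) auto
    also have "(norm z)\<^sup>2 * (- 2 * pi) \<le> (norm z)\<^sup>2 * (ln (norm (w + 1)) / (2 * s) - 2 * pi)"
      using ln0 s by (intro mult_left_mono) auto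
    finally show ?thesis using E by (simp add: algebra_simps)
  qed
qed

lemma shift_avg_max_principle:
  assumes "g holomorphic_on UNIV" "compact K" "q holomorphic_on interior K" "continuous_on K q"
    and "\<And>z. z \<in> frontier K \<Longrightarrow> shift_avg g z + Re (q z) \<le> B" and "z0 \<in> K"
  shows "shift_avg g z0 + Re (q z0) \<le> B"
proof -
  have g: "continuous_on UNIV g" using assms(1) by (rule holomorphic_on_imp_continuous_on)
  have "(\<lambda>z. g (z + of_real (2 * t - 1))) holomorphic_on UNIV" for t
    by (rule holomorphic_compose_UNIV[OF assms(1)]) (intro holomorphic_intros)
  moreover have "continuous_on UNIV (\<lambda>(t, z). g (z + of_real (2 * t - 1)))"
    unfolding case_prod_beta
    by (rule continuous_on_compose2[OF g]) (auto intro!: continuous_intros)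
  ultimately show ?thesis
    using assms max_principle_integral_ln[of "\<lambda>t z. g (z + of_real (2 * t - 1))" K q B z0]
    by (simp add: shift_avg_def)
qed

text \<open>The sector below the ray \<open>\<epsilon> y = b x\<close> is narrower than the
  quadrant, so quadratic growth is subcritical there and a small multiple \<open>\<delta>\<close> of
  the barrier controls the arc. Subtracting \<open>2 \<epsilon> x y\<close> takes care of the ray.
  The limit \<open>\<delta> \<rightarrow> 0\<close> comes before
  \<open>\<epsilon> \<rightarrow> 0\<close>, because the barrier depends on the slope
  \<open>s = b / \<epsilon>\<close>.\<close>

lemma shift_avg_quadrant:
  assumes hol: "g holomorphic_on UNIV" and b: "b > 0"
    and real: "\<And>x. shift_avg g (of_real x) \<le> M"
    and grow: "\<And>z. shift_avg g z \<le> M + b * (Re z)\<^sup>2"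
    and z0: "Re z0 \<ge> 0" "Im z0 \<ge> 0"
  shows "shift_avg g z0 \<le> M"
proof (cases "Re z0 = 0")
  case True
  then show ?thesis using grow[of z0] by simp
next
  case False
  then have x0: "Re z0 > 0" using z0 by simp
  show ?thesis
  proof (rule le_if_le_add_small)
    \<comment> \<open>\<open>\<epsilon> \<le> b\<close> gives the slope \<open>s \<ge> 1\<close>
      that the barrier requires; the second bound places \<open>z0\<close> inside the
      sector.\<close>
    show "min b (b * Re z0 / (Im z0 + 1)) > 0" using b x0 z0 by (auto intro!: divide_pos_pos)
    fix \<epsilon> :: real assume \<epsilon>: "0 < \<epsilon>" "\<epsilon> \<le> min b (b * Re z0 / (Im z0 + 1))"
    then have "\<epsilon> * (Im z0 + 1) \<le> b * Re z0" using z0 by (simp add: field_simps)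
    then have \<epsilon>z: "\<epsilon> * Im z0 \<le> b * Re z0" using \<epsilon> by (simp add: algebra_simps)
    define s where "s = b / \<epsilon>"
    have s: "s \<ge> 1" and slope: "y \<le> s * x \<longleftrightarrow> \<epsilon> * y \<le> b * x" for x y
      using \<epsilon> b by (auto simp: s_def field_simps)
    define W where "W z = Complex 1 (1 / (4 * s)) * z" for z
    define E where "E z = Im ((W z)\<^sup>2 * Ln (W z + 1))" for z
    have "shift_avg g z0 \<le> (M + \<epsilon> * (2 * Re z0 * Im z0))"
    proof (rule le_if_le_add_small)
      fix \<delta> :: real assume \<delta>: "0 < \<delta>" "\<delta> \<le> 1"
      \<comment> \<open>Chosen so that \<open>\<delta> E \<ge> b R^2\<close> on the arc: there
        \<open>ln |W z + 1| / (2 s) - 2 pi\<close> is at least \<open>b / \<delta>\<close>.\<close>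
      define R where "R = max (norm z0) (exp (2 * s * (2 * pi + b / \<delta>)))"
      define K where "K = {z. 0 \<le> Im z} \<inter> {z. \<epsilon> * Im z \<le> b * Re z} \<inter> cball 0 R"
      \<comment> \<open>A holomorphic function whose real part is the correction
        \<open>- 2 \<epsilon> x y - \<delta> E\<close>.\<close>
      define q where "q z = \<i> * of_real \<epsilon> * z\<^sup>2 + \<i> * of_real \<delta> * ((W z)\<^sup>2 * Ln (W z + 1))" for z
      have Req: "Re (q z) = - 2 * \<epsilon> * (Re z * Im z) - \<delta> * E z" for z
        by (simp add: q_def E_def power2_eq_square algebra_simps)
      have sect: "0 \<le> Im z" "Im z \<le> s * Re z" if "z \<in> K" for z
        using that by (auto simp: K_def slope)
      have "closed {z. \<epsilon> * Im z \<le> b * Re z}" "closed {z. 0 \<le> Im z}"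
        by (intro closed_Collect_le continuous_intros)+
      then have K: "compact K"
        unfolding K_def by (intro closed_Int_compact closed_Int compact_cball)
      \<comment> \<open>Adding 1 to \<open>W z\<close> keeps the argument of \<open>Ln\<close> in
        \<open>Re \<ge> 1\<close>, so holomorphy extends to the closed sector including its
        vertex.\<close>
      have qhol: "q holomorphic_on K"
        unfolding q_def W_def
      proof (intro holomorphic_intros)
        fix z assume "z \<in> K"
        from sector_barrier(1)[OF s sect[OF this]]
        show "Complex 1 (1 / (4 * s)) * z + 1 \<notin> \<real>\<^sub>\<le>\<^sub>0"
          by (auto simp: complex_nonpos_Reals_iff)
      qed
      \<comment> \<open>The allowance is \<open>\<delta>\<close> times the deepest possible negative
        value of the barrier and disappears with \<open>\<delta>\<close>.\<close>
      have "shift_avg g z0 + Re (q z0) \<le> M + \<delta> * (2 * pi * exp (8 * pi * s))"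
      proof (rule shift_avg_max_principle[OF hol K])
        show "q holomorphic_on interior K" "continuous_on K q"
          using qhol interior_subset holomorphic_on_subset holomorphic_on_imp_continuous_on by blast+
        show "z0 \<in> K" using z0 \<epsilon>z by (auto simp: K_def R_def)
        fix z assume "z \<in> frontier K"
        then have zK: "z \<in> K" and "z \<notin> interior K"
          using K by (auto simp: frontier_def compact_imp_closed)
        have x: "0 \<le> Re z"
          using sect[OF zK] s by (metis dual_order.trans linorder_not_le mult_pos_neg not_one_le_zero order_less_le_trans zero_less_one less_le_not_le)
        have "open ({z. 0 < Im z} \<inter> {z. \<epsilon> * Im z < b * Re z} \<inter> ball 0 R)" (is "open ?O")
          by (intro open_Int open_Collect_less continuous_intros open_ball)
        moreover have "?O \<subseteq> K" by (auto simp: K_def)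
        ultimately have "z \<notin> ?O" using \<open>z \<notin> interior K\<close> interior_maximal by blast
        then consider "Im z = 0" | "\<epsilon> * Im z = b * Re z" | "norm z = R"
          using zK by (auto simp: K_def)
        then show "shift_avg g z + Re (q z) \<le> M + \<delta> * (2 * pi * exp (8 * pi * s))"
        proof cases
          case 3
          have R0: "R > 0" "ln R \<ge> 2 * s * (2 * pi + b / \<delta>)"
          proof -
            show "R > 0" by (simp add: R_def less_max_iff_disj)
            then have "ln (exp (2 * s * (2 * pi + b / \<delta>))) \<le> ln R"
              unfolding R_def by (intro ln_le_cancel_iff[THEN iffD2]) auto
            then show "ln R \<ge> 2 * s * (2 * pi + b / \<delta>)" by simp
          qed
          have "ln R \<le> ln (norm (W z + 1))"
            using sector_barrier(2,3)[OF s sect[OF zK]] R0 3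
            by (subst ln_le_cancel_iff) (auto simp: W_def)
          with R0 have "2 * s * (2 * pi + b / \<delta>) \<le> ln (norm (W z + 1))" by linarith
          then have "b / \<delta> \<le> ln (norm (W z + 1)) / (2 * s) - 2 * pi"
            using s by (simp add: field_simps)
          then have "R\<^sup>2 * (b / \<delta>) \<le> R\<^sup>2 * (ln (norm (W z + 1)) / (2 * s) - 2 * pi)"
            by (intro mult_left_mono) auto
          also have "\<dots> \<le> E z"
            using sector_barrier(4)[OF s sect[OF zK]] 3 by (simp add: W_def E_def)
          finally have "b * R\<^sup>2 \<le> \<delta> * E z" using \<delta> by (simp add: field_simps)
          moreover have "b * (Re z)\<^sup>2 \<le> b * R\<^sup>2"
            using b 3 abs_Re_le_cmod[of z] by (intro mult_left_mono) (auto simp: abs_le_square_iff[symmetric])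
          moreover have "0 \<le> \<epsilon> * (Re z * Im z)" using \<epsilon> x sect[OF zK] by simp
          moreover have "0 \<le> \<delta> * (2 * pi * exp (8 * pi * s))" using \<delta> by simp
          ultimately show ?thesis using grow[of z] unfolding Req by linarith
        next
          case 1
          then have "z = of_real (Re z)" by (simp add: complex_eq_iff)
          then have "shift_avg g z \<le> M" using real by metis
          moreover have "\<delta> * (- (2 * pi * exp (8 * pi * s))) \<le> \<delta> * E z"
            using \<delta> sector_barrier(5)[OF s sect[OF zK]] by (intro mult_left_mono) (auto simp: E_def W_def)
          ultimately show ?thesis using 1 unfolding Req by simp
        next
          case 2
          \<comment> \<open>On the ray the correction \<open>2 \<epsilon> x y\<close> equals
            \<open>2 b x^2\<close>, twice what the growth bound requires.\<close>
          have "\<epsilon> * (Re z * Im z) = b * (Re z)\<^sup>2"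
            using 2 by (simp add: power2_eq_square algebra_simps)
          moreover have "0 \<le> b * (Re z)\<^sup>2" using b by simp
          moreover have "\<delta> * (- (2 * pi * exp (8 * pi * s))) \<le> \<delta> * E z"
            using \<delta> sector_barrier(5)[OF s sect[OF zK]] by (intro mult_left_mono) (auto simp: E_def W_def)
          ultimately show ?thesis using grow[of z] unfolding Req by (simp add: algebra_simps)
        qed
      qed
      then show "shift_avg g z0 \<le> M + \<epsilon> * (2 * Re z0 * Im z0) + \<delta> * (2 * pi * exp (8 * pi * s) + E z0)"
        unfolding Req by (simp add: algebra_simps)
    qed simp
    then show "shift_avg g z0 \<le> M + \<epsilon> * (2 * Re z0 * Im z0)" .
  qed
qed

lemma continuous_on_ln_1_norm:
  assumes "continuous_on S f"
  shows "continuous_on S (\<lambda>x. ln (1 + norm (f x :: 'a :: real_normed_vector)))"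
  by (intro continuous_intros assms) (auto simp: add_nonneg_eq_0_iff)

lemma continuous_on_shift:
  fixes g :: "complex \<Rightarrow> complex"
  assumes "continuous_on UNIV g"
  shows "continuous_on S (\<lambda>t::real. ln (1 + norm (g (z + of_real (2 * t - 1)))))"
  by (intro continuous_on_ln_1_norm continuous_on_compose2[OF assms]) (auto intro!: continuous_intros)

lemma surj_cnj: "range cnj = UNIV"
  by (metis complex_cnj_cnj surj_def)

text \<open>The window is symmetric: replacing \<open>t\<close> by \<open>1 - t\<close> turns
  \<open>2 t - 1\<close> into its negative.\<close>

lemma shift_avg_uminus:
  assumes "continuous_on UNIV g"
  shows "shift_avg (\<lambda>z. g (- z)) z = shift_avg g (- z)"
proof -
  have "continuous_on UNIV (\<lambda>z. g (- z))"
    using assms by (rule continuous_on_compose2) (auto intro!: continuous_intros)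
  note c = continuous_on_shift[OF this, of "{0..1}" z]
  let ?f = "\<lambda>t. ln (1 + norm (g (- (z + of_real (2 * t - 1)))))"
  have "integral {0..1} ?f = integral {- 1 .. - 0} (\<lambda>t. ?f (- t))"
    by (rule Henstock_Kurzweil_Integration.integral_reflect_real[symmetric])
  also have "\<dots> = integral {-1 + 1..-0 + 1} (\<lambda>t. ?f (- (t - 1)))"
    using integral_shift_Icc_real[of "-1" "- 0" "\<lambda>t. ?f (- (t - 1))" 1] by (simp add: o_def)
  finally show ?thesis by (simp add: shift_avg_def algebra_simps)
qed

lemma shift_avg_cnj: "shift_avg (\<lambda>z. cnj (g (cnj z))) z = shift_avg g (cnj z)"
  by (simp add: shift_avg_def)

text \<open>Conjugation and \<open>z \<mapsto> - z\<close> permute the quadrants, and both preserve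
  the real axis and \<open>(Re z)^2\<close>, so the first quadrant suffices.\<close>

lemma shift_avg_bounded:
  assumes hol: "g holomorphic_on UNIV" and b: "b > 0"
    and real: "\<And>x. shift_avg g (of_real x) \<le> M"
    and grow: "\<And>z. shift_avg g z \<le> M + b * (Re z)\<^sup>2"
  shows "shift_avg g z \<le> M"
proof -
  have upper: "shift_avg g z \<le> M"
    if hol: "g holomorphic_on UNIV" and real: "\<And>x. shift_avg g (of_real x) \<le> M"
      and grow: "\<And>z. shift_avg g z \<le> M + b * (Re z)\<^sup>2" and z: "Re z \<ge> 0" for g z
  proof (cases "Im z \<ge> 0")
    case True
    then show ?thesis using shift_avg_quadrant[OF hol b real grow] z by blast
  next
    case False
    have "(\<lambda>z. cnj (g (cnj z))) holomorphic_on UNIV"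
      using holomorphic_on_compose_cnj_cnj[of g UNIV] hol by (simp add: o_def surj_cnj)
    then have "shift_avg (\<lambda>z. cnj (g (cnj z))) (cnj z) \<le> M"
      by (rule shift_avg_quadrant[OF _ b]) (use False z real grow[of "cnj _"] in \<open>auto simp: shift_avg_cnj\<close>)
    then show ?thesis by (simp add: shift_avg_cnj)
  qed
  show ?thesis
  proof (cases "Re z \<ge> 0")
    case False
    have c: "continuous_on UNIV g" using hol by (rule holomorphic_on_imp_continuous_on)
    have "(\<lambda>z. g (- z)) holomorphic_on UNIV"
      by (rule holomorphic_compose_UNIV[OF hol]) (intro holomorphic_intros)
    then have "shift_avg (\<lambda>z. g (- z)) (- z) \<le> M"
      by (rule upper) (use False real[of "- _"] grow[of "- _"] in \<open>auto simp: shift_avg_uminus[OF c]\<close>)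
    then show ?thesis by (simp add: shift_avg_uminus[OF c])
  qed (use upper[OF hol real grow] in auto)
qed

section \<open>Mean value inequalities on circles and discs\<close>

lemma integral_periodic_shift:
  fixes f :: "real \<Rightarrow> real"
  assumes cont: "continuous_on UNIV f" and per: "\<And>t. f (t + 1) = f t" and s: "0 \<le> s" "s \<le> 1"
  shows "integral {0..1} (\<lambda>t. f (t + s)) = integral {0..1} f"
proof -
  have int: "f integrable_on {a..b}" for a b
    by (intro integrable_continuous_real continuous_on_subset[OF cont]) auto
  have "integral {0..1} (\<lambda>t. f (t + s)) = integral {0 + s..1 + s} f"
    using integral_shift_Icc_real[of 0 1 f s] by (simp add: o_def add.commute)
  also have "\<dots> = integral {s..1} f + integral {1..1 + s} f"
    using s int by (subst Henstock_Kurzweil_Integration.integral_combine) auto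
  also have "integral {1..1 + s} f = integral {0..s} f"
    using integral_shift_Icc_real[of 0 s f 1] per by (simp add: o_def add.commute)
  also have "integral {s..1} f + integral {0..s} f = integral {0..1} f"
    using s int Henstock_Kurzweil_Integration.integral_combine[of 0 s 1 f] by simp
  finally show ?thesis .
qed

text \<open>The maximum principle is applied in the scaling variable \<open>\<zeta>\<close> of
  \<open>z0 + \<zeta> * cis (2 * pi * t)\<close>. At \<open>\<zeta> = 0\<close> the integrand is
  constant in \<open>t\<close>; on the frontier \<open>|\<zeta>| = |w|\<close> the argument of
  \<open>\<zeta>\<close> only shifts \<open>t\<close>, and by periodicity the integral does not
  change. So the frontier bound is the circle mean itself.\<close>

lemma ln_1_norm_le_circle_mean:
  assumes hol: "g holomorphic_on UNIV"
  shows "ln (1 + norm (g z0)) \<le> integral {0..1} (\<lambda>t. ln (1 + norm (g (z0 + w * cis (2 * pi * t)))))"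
proof -
  have g: "continuous_on UNIV g" using hol by (rule holomorphic_on_imp_continuous_on)
  define h where "h t \<zeta> = g (z0 + \<zeta> * cis (2 * pi * t))" for t and \<zeta> :: complex
  have ccis: "continuous_on UNIV (\<lambda>p::real \<times> complex. z0 + snd p * cis (2 * pi * fst p))"
    by (simp add: cis_conv_exp) (intro continuous_intros)
  have "integral {0..1} (\<lambda>t. ln (1 + norm (h t 0))) + Re 0
      \<le> integral {0..1} (\<lambda>t. ln (1 + norm (h t w)))"
  proof (rule max_principle_integral_ln[where K = "cball 0 (norm w)" and q = "\<lambda>_. 0"])
    show "h t holomorphic_on UNIV" for t
      unfolding h_def by (rule holomorphic_compose_UNIV[OF hol]) (intro holomorphic_intros)
    show "continuous_on UNIV (\<lambda>(t, z). h t z)"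
      unfolding h_def case_prod_beta by (rule continuous_on_compose2[OF g ccis]) auto
    fix \<zeta> :: complex assume "\<zeta> \<in> frontier (cball 0 (norm w))"
    then have n: "norm \<zeta> = norm w"
      by (cases "w = 0") (simp_all add: frontier_def[of "{0}"] frontier_cball)
    obtain s where s: "0 \<le> s" "s \<le> 1" "\<zeta> = w * cis (2 * pi * s)"
    proof (cases "w = 0")
      case True
      then show ?thesis using n that[of 0] by simp
    next
      case False
      define u where "u = \<zeta> / w"
      have "norm u = 1" using n False by (simp add: u_def norm_divide)
      then obtain \<phi> where "0 \<le> \<phi>" "\<phi> < 2 * pi" "u = cis \<phi>"
        using complex_unimodular_polar[of u] by (metis cis.ctr complex.exhaust_sel complex_eq_iff)
      then show ?thesis using that[of "\<phi> / (2 * pi)"] False by (simp add: u_def field_simps)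
    qed
    have "integral {0..1} (\<lambda>t. ln (1 + norm (h t \<zeta>))) = integral {0..1} (\<lambda>t. ln (1 + norm (h (t + s) w)))"
      by (simp add: h_def s mult.assoc cis_mult distrib_left add.commute)
    also have "\<dots> = integral {0..1} (\<lambda>t. ln (1 + norm (h t w)))"
    proof (rule integral_periodic_shift[where f = "\<lambda>t. ln (1 + norm (h t w))"])
      show "continuous_on UNIV (\<lambda>t. ln (1 + norm (h t w)))"
        unfolding h_def
        by (intro continuous_on_ln_1_norm continuous_on_compose2[OF g])
          (auto simp: cis_conv_exp intro!: continuous_intros)
      show "ln (1 + norm (h (t + 1) w)) = ln (1 + norm (h t w))" for t
        by (simp add: h_def distrib_left flip: cis_mult)
    qed (use s in auto)
    finally show "integral {0..1} (\<lambda>t. ln (1 + norm (h t \<zeta>))) + Re 0 \<le> integral {0..1} (\<lambda>t. ln (1 + norm (h t w)))"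
      by simp
  qed auto
  then show ?thesis by (simp add: h_def)
qed

lemma nn_integral_lborel_pair:
  fixes f :: "'a::euclidean_space \<times> 'b::euclidean_space \<Rightarrow> ennreal"
  assumes "f \<in> borel_measurable borel"
  shows "(\<integral>\<^sup>+p. f p \<partial>lborel) = (\<integral>\<^sup>+x. \<integral>\<^sup>+y. f (x, y) \<partial>lborel \<partial>lborel)"
    and "(\<integral>\<^sup>+p. f p \<partial>lborel) = (\<integral>\<^sup>+y. \<integral>\<^sup>+x. f (x, y) \<partial>lborel \<partial>lborel)"
proof -
  have f: "f \<in> borel_measurable (lborel \<Otimes>\<^sub>M lborel)"
    using assms by (simp add: lborel_prod)
  show "(\<integral>\<^sup>+p. f p \<partial>lborel) = (\<integral>\<^sup>+x. \<integral>\<^sup>+y. f (x, y) \<partial>lborel \<partial>lborel)"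
    using lborel.nn_integral_fst[OF f] by (simp add: lborel_prod)
  show "(\<integral>\<^sup>+p. f p \<partial>lborel) = (\<integral>\<^sup>+y. \<integral>\<^sup>+x. f (x, y) \<partial>lborel \<partial>lborel)"
    using lborel_pair.nn_integral_snd[OF f] by (simp add: lborel_prod)
qed

text \<open>Two affine substitutions in one variable, separated by Fubini, turn the rotated point
  into \<open>(x, x * s / c + y / c)\<close> and then into \<open>(x, y)\<close>; their factors
  \<open>1 / |c|\<close> and \<open>|c|\<close> cancel. Dividing by \<open>c\<close> excludes the
  quarter turns, which form a null set of angles.\<close>

lemma nn_integral_rotation:
  fixes f :: "real \<times> real \<Rightarrow> ennreal"
  assumes f[measurable]: "f \<in> borel_measurable borel" and cs: "c\<^sup>2 + s\<^sup>2 = 1" "c \<noteq> 0"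
  shows "(\<integral>\<^sup>+p. f (c * fst p - s * snd p, s * fst p + c * snd p) \<partial>lborel) = (\<integral>\<^sup>+p. f p \<partial>lborel)"
proof -
  have "(\<lambda>p::real \<times> real. (c * fst p - s * snd p, s * fst p + c * snd p)) \<in> borel_measurable borel"
    by (intro borel_measurable_continuous_onI continuous_intros)
  then have rot: "(\<lambda>p. f (c * fst p - s * snd p, s * fst p + c * snd p)) \<in> borel_measurable borel"
    using f by (rule measurable_compose)
  have [measurable]: "f \<in> borel_measurable (borel \<Otimes>\<^sub>M borel)" by (simp add: borel_prod)
  have "(\<integral>\<^sup>+p. f (c * fst p - s * snd p, s * fst p + c * snd p) \<partial>lborel)
      = (\<integral>\<^sup>+y. \<integral>\<^sup>+x. f (c * x - s * y, s * x + c * y) \<partial>lborel \<partial>lborel)"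
    using rot by (subst nn_integral_lborel_pair(2)) auto
  also have "\<dots> = (\<integral>\<^sup>+y. ennreal \<bar>1 / c\<bar> * (\<integral>\<^sup>+x. f (x, x * s / c + y / c) \<partial>lborel) \<partial>lborel)"
  proof (rule nn_integral_cong)
    fix y :: real
    have eq: "s * (s * y / c + 1 / c * x) + c * y = x * s / c + y / c" for x
    proof -
      have "s * (s * y / c + 1 / c * x) + c * y = x * s / c + y * (c\<^sup>2 + s\<^sup>2) / c"
        using cs(2) by (simp add: field_simps power2_eq_square)
      then show ?thesis by (simp add: cs)
    qed
    show "(\<integral>\<^sup>+x. f (c * x - s * y, s * x + c * y) \<partial>lborel)
        = ennreal \<bar>1 / c\<bar> * (\<integral>\<^sup>+x. f (x, x * s / c + y / c) \<partial>lborel)"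
      using cs(2) eq
      by (subst nn_integral_real_affine[where c = "1 / c" and t = "s * y / c"]) (auto simp: field_simps)
  qed
  also have "\<dots> = (\<integral>\<^sup>+y. \<integral>\<^sup>+x. ennreal \<bar>1 / c\<bar> * f (x, x * s / c + y / c) \<partial>lborel \<partial>lborel)"
    by (simp add: nn_integral_cmult)
  also have "\<dots> = (\<integral>\<^sup>+x. \<integral>\<^sup>+y. ennreal \<bar>1 / c\<bar> * f (x, x * s / c + y / c) \<partial>lborel \<partial>lborel)"
    by (rule lborel_pair.Fubini') measurable
  also have "\<dots> = (\<integral>\<^sup>+x. \<integral>\<^sup>+y. f (x, y) \<partial>lborel \<partial>lborel)"
  proof (rule nn_integral_cong)
    fix x :: real
    show "(\<integral>\<^sup>+y. ennreal \<bar>1 / c\<bar> * f (x, x * s / c + y / c) \<partial>lborel) = (\<integral>\<^sup>+y. f (x, y) \<partial>lborel)"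
      using cs(2)
      by (subst (2) nn_integral_real_affine[where c = "1 / c" and t = "x * s / c"])
        (auto simp: nn_integral_cmult)
  qed
  also have "\<dots> = (\<integral>\<^sup>+p. f p \<partial>lborel)"
    by (subst nn_integral_lborel_pair(1)) auto
  finally show ?thesis .
qed

lemma log_plus_nonneg: "0 \<le> log_plus x"
  by (simp add: log_plus_def)

lemma log_plus_eq_ln_max: "log_plus x = ln (max 1 x)"
  by (simp add: log_plus_def max_def)

lemma log_plus_mono: "x \<le> y \<Longrightarrow> log_plus x \<le> log_plus y"
  by (simp add: log_plus_def)

lemma borel_measurable_log_plus [measurable]: "log_plus \<in> borel_measurable borel"
  unfolding log_plus_def[abs_def] by measurable

text \<open>From \<open>1 + x \<le> 2 * max 1 x\<close>.\<close>

lemma ln_1_add_le_log_plus: "0 \<le> x \<Longrightarrow> ln (1 + x) \<le> ln 2 + log_plus x"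
  unfolding log_plus_eq_ln_max by (subst ln_mult_pos[symmetric]) (auto simp: ln_le_cancel_iff)

lemma shift_avg_nn_integral:
  assumes "continuous_on UNIV g"
  shows "ennreal (shift_avg g z) =
    (\<integral>\<^sup>+t. ennreal (ln (1 + norm (g (z + of_real (2 * t - 1))))) * indicator {0..1} t \<partial>lborel)"
  unfolding shift_avg_def
  by (rule nn_integral_has_integral_lebesgue'[symmetric], simp)
    (intro integrable_integral integrable_continuous_real continuous_on_shift[OF assms])

lemma shift_avg_real_le:
  assumes g: "continuous_on UNIV g"
    and fin: "(\<integral>\<^sup>+x. ennreal (log_plus (norm (g (of_real x)))) \<partial>lborel) = ennreal L" and L: "0 \<le> L"
  shows "shift_avg g (of_real x) \<le> ln 2 + L"
proof -
  have [measurable]: "(\<lambda>x::real. g (of_real x)) \<in> borel_measurable borel"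
    by (intro borel_measurable_continuous_onI continuous_on_compose2[OF g] continuous_intros) auto
  have meas: "(\<lambda>x. ennreal (log_plus (norm (g (of_real x))))) \<in> borel_measurable borel" by measurable
  have "(\<lambda>t::real. g (of_real (x - 1 + 2 * t))) \<in> borel_measurable borel"
    by (rule borel_measurable_continuous_onI, rule continuous_on_compose2[OF g]) (auto intro!: continuous_intros)
  then have [measurable]: "(\<lambda>t. log_plus (norm (g (of_real (x - 1 + 2 * t))))) \<in> borel_measurable borel"
    by measurable
  let ?l = "\<lambda>t. log_plus (norm (g (of_real (x - 1 + 2 * t))))"
  have "ennreal (shift_avg g (of_real x)) \<le> (\<integral>\<^sup>+t. ennreal (ln 2) * indicator {0..1} t + ennreal (?l t) \<partial>lborel)"
    unfolding shift_avg_nn_integral[OF g]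
  proof (rule nn_integral_mono)
    fix t :: real
    have "ln (1 + norm (g (of_real x + of_real (2 * t - 1)))) \<le> ln 2 + ?l t"
      using ln_1_add_le_log_plus[of "norm (g (of_real (x - 1 + 2 * t)))"] by (simp add: algebra_simps)
    then show "ennreal (ln (1 + norm (g (of_real x + of_real (2 * t - 1))))) * indicator {0..1} t
      \<le> ennreal (ln 2) * indicator {0..1} t + ennreal (?l t)"
      by (auto simp: indicator_def log_plus_nonneg simp flip: ennreal_plus intro!: ennreal_leI)
  qed
  also have "\<dots> = ennreal (ln 2) + (\<integral>\<^sup>+t. ennreal (?l t) \<partial>lborel)"
    by (subst nn_integral_add)
      (auto simp: nn_integral_cmult_indicator simp del: of_real_add of_real_diff of_real_mult)
  \<comment> \<open>The harmless factor 2 is the Jacobian of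
    \<open>t \<mapsto> x - 1 + 2 * t\<close>; with it the integral becomes exactly
    \<open>L\<close>.\<close>
  also have "\<dots> \<le> ennreal (ln 2) + 2 * (\<integral>\<^sup>+t. ennreal (?l t) \<partial>lborel)"
    using mult_right_mono[of 1 2 "\<integral>\<^sup>+t. ennreal (?l t) \<partial>lborel"] by (intro add_left_mono) simp
  also have "2 * (\<integral>\<^sup>+t. ennreal (?l t) \<partial>lborel) = ennreal L"
    using nn_integral_real_affine[OF meas, of 2 "x - 1"] fin by simp
  also have "ennreal (ln 2) + ennreal L = ennreal (ln 2 + L)"
    using L by (simp add: ennreal_plus)
  finally show ?thesis using L by (subst (asm) ennreal_le_iff) (auto intro: add_nonneg_nonneg)
qed

text \<open>An area mean inequality without polar coordinates: the circle inequality holds for the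
  circle through every \<open>p\<close>, and integrating it over \<open>p\<close> in the unit disc
  \<open>D\<close> leaves the integral of \<open>u\<close> over \<open>D\<close> by rotation
  invariance. From below \<open>D\<close> is replaced by an inscribed square of area 1, from above
  by \<open>[-1, 1]^2\<close>. Each horizontal slice of the larger square is twice a
  \<open>shift_avg\<close>, and the slices fill a height of 2; hence the factor 4.\<close>

lemma ln_1_norm_le_if_shift_avg_le:
  assumes hol: "g holomorphic_on UNIV" and M: "\<And>z. shift_avg g z \<le> M"
  shows "ln (1 + norm (g z0)) \<le> 4 * M"
proof -
  have g: "continuous_on UNIV g" using hol by (rule holomorphic_on_imp_continuous_on)
  have "0 \<le> shift_avg g z0"
    unfolding shift_avg_def
    by (intro integral_nonneg integrable_continuous_real continuous_on_shift[OF g]) simp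
  then have M0: "0 \<le> M" using M[of z0] by linarith
  define u where "u p = ennreal (ln (1 + norm (g (z0 + Complex (fst p) (snd p)))))" for p :: "real \<times> real"
  define D where "D = {p::real \<times> real. (fst p)\<^sup>2 + (snd p)\<^sup>2 \<le> 1}"
  define rot where "rot \<theta> p = (cos \<theta> * fst p - sin \<theta> * snd p, sin \<theta> * fst p + cos \<theta> * snd p)"
    for \<theta> :: real and p :: "real \<times> real"
  have cont_u: "continuous_on UNIV (\<lambda>p::real \<times> real. ln (1 + norm (g (z0 + Complex (fst p) (snd p)))))"
    unfolding complex_eq
    by (intro continuous_on_ln_1_norm continuous_on_compose2[OF g] continuous_intros) auto
  then have [measurable]: "u \<in> borel_measurable borel"
    unfolding u_def by (intro measurable_compose[OF _ measurable_ennreal] borel_measurable_continuous_onI)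
  then have [measurable]: "u \<in> borel_measurable (borel \<Otimes>\<^sub>M borel)" by (simp add: borel_prod)
  have "closed D"
    unfolding D_def by (intro closed_Collect_le continuous_intros)
  then have [measurable]: "D \<in> sets borel" by simp
  have "(\<lambda>q. rot (2 * pi * fst q) (snd q)) \<in> borel_measurable borel"
    unfolding rot_def by (intro borel_measurable_continuous_onI continuous_intros)
  then have [measurable]: "(\<lambda>q. rot (2 * pi * fst q) (snd q)) \<in> borel_measurable (borel \<Otimes>\<^sub>M borel)"
    by (simp add: borel_prod)
  have [measurable]: "(\<lambda>t. rot (2 * pi * t) p) \<in> borel_measurable borel" for p
    unfolding rot_def by (intro borel_measurable_continuous_onI continuous_intros)
  have rotD: "rot \<theta> p \<in> D \<longleftrightarrow> p \<in> D" for \<theta> p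
  proof -
    have "(fst (rot \<theta> p))\<^sup>2 + (snd (rot \<theta> p))\<^sup>2 = ((cos \<theta>)\<^sup>2 + (sin \<theta>)\<^sup>2) * ((fst p)\<^sup>2 + (snd p)\<^sup>2)"
    proof -
      have "(c * a - s * b)\<^sup>2 + (s * a + c * b)\<^sup>2 = (c\<^sup>2 + s\<^sup>2) * (a\<^sup>2 + b\<^sup>2)" for c s a b :: real
        by (simp add: power2_eq_square algebra_simps)
      then show ?thesis by (simp only: rot_def fst_conv snd_conv)
    qed
    then show ?thesis by (simp add: D_def)
  qed
  then have indrot: "indicator D (rot \<theta> p) = (indicator D p :: ennreal)" for \<theta> p
    by (simp add: indicator_def)
  have mean: "ennreal (ln (1 + norm (g z0))) \<le> (\<integral>\<^sup>+t. u (rot (2 * pi * t) p) * indicator {0..1} t \<partial>lborel)" for p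
  proof -
    let ?w = "Complex (fst p) (snd p)"
    have w: "?w * cis (2 * pi * t) = Complex (fst (rot (2 * pi * t) p)) (snd (rot (2 * pi * t) p))" for t
      by (simp add: complex_eq_iff rot_def algebra_simps)
    have "continuous_on {0..1} (\<lambda>t. ln (1 + norm (g (z0 + ?w * cis (2 * pi * t)))))"
      by (intro continuous_on_ln_1_norm continuous_on_compose2[OF g]) (auto simp: cis_conv_exp intro!: continuous_intros)
    note int = integrable_integral[OF integrable_continuous_real[OF this]]
    have "ennreal (ln (1 + norm (g z0))) \<le> ennreal (integral {0..1} (\<lambda>t. ln (1 + norm (g (z0 + ?w * cis (2 * pi * t))))))"
      by (intro ennreal_leI ln_1_norm_le_circle_mean[OF hol])
    also have "\<dots> = (\<integral>\<^sup>+t. ennreal (ln (1 + norm (g (z0 + ?w * cis (2 * pi * t))))) * indicator {0..1} t \<partial>lborel)"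
      by (rule nn_integral_has_integral_lebesgue'[symmetric, OF _ int]) simp
    also have "\<dots> = (\<integral>\<^sup>+t. u (rot (2 * pi * t) p) * indicator {0..1} t \<partial>lborel)"
      by (simp only: u_def w)
    finally show ?thesis .
  qed
  have "ennreal (ln (1 + norm (g z0))) = ennreal (ln (1 + norm (g z0))) * emeasure lborel (cbox (-1/2, -1/2) (1/2 :: real, 1/2 :: real))"
    by (simp add: emeasure_lborel_cbox_eq Basis_prod_def)
  also have "\<dots> = (\<integral>\<^sup>+p. ennreal (ln (1 + norm (g z0))) * indicator (cbox (-1/2, -1/2) (1/2 :: real, 1/2 :: real)) p \<partial>lborel)"
    by (subst nn_integral_cmult_indicator) auto
  also have "\<dots> \<le> (\<integral>\<^sup>+p. (\<integral>\<^sup>+t. u (rot (2 * pi * t) p) * indicator {0..1} t \<partial>lborel) * indicator D p \<partial>lborel)"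
  proof (intro nn_integral_mono mult_mono mean)
    fix p :: "real \<times> real"
    have "p \<in> D" if "p \<in> cbox (-1/2, -1/2) (1/2, 1/2)"
    proof -
      have "\<bar>fst p\<bar> \<le> 1/2" "\<bar>snd p\<bar> \<le> 1/2" using that by (cases p; auto)+
      from power_mono[OF this(1), of 2] power_mono[OF this(2), of 2]
      show ?thesis by (simp add: D_def power2_eq_square)
    qed
    then show "indicator (cbox (-1/2, -1/2) (1/2 :: real, 1/2 :: real)) p \<le> (indicator D p :: ennreal)"
      by (auto simp: indicator_def)
  qed auto
  also have "\<dots> = (\<integral>\<^sup>+p. \<integral>\<^sup>+t. u (rot (2 * pi * t) p) * indicator {0..1} t * indicator D (rot (2 * pi * t) p) \<partial>lborel \<partial>lborel)"
    by (simp add: nn_integral_multc indrot)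
  also have "\<dots> = (\<integral>\<^sup>+t. \<integral>\<^sup>+p. u (rot (2 * pi * t) p) * indicator {0..1} t * indicator D (rot (2 * pi * t) p) \<partial>lborel \<partial>lborel)"
    by (rule lborel_pair.Fubini') measurable
  also have "\<dots> = (\<integral>\<^sup>+t. (\<integral>\<^sup>+p. u p * indicator D p \<partial>lborel) * indicator {0..1::real} t \<partial>lborel)"
  proof (rule nn_integral_cong_AE)
    \<comment> \<open>Angles with vanishing cosine are the ones that
      \<open>nn_integral_rotation\<close> does not cover.\<close>
    have "countable {t::real. cos (2 * pi * t) = 0}"
    proof (rule countable_subset)
      show "{t::real. cos (2 * pi * t) = 0} \<subseteq> range (\<lambda>i::int. of_int i / 4)"
      proof
        fix t :: real assume "t \<in> {t. cos (2 * pi * t) = 0}"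
        then obtain i :: int where "4 * t = of_int i" by (auto simp: cos_zero_iff_int)
        then have "t = of_int i / 4" by simp
        then show "t \<in> range (\<lambda>i::int. of_int i / 4)" by (rule range_eqI)
      qed
    qed simp
    then have "{t::real. cos (2 * pi * t) = 0} \<in> null_sets lborel"
      by (rule countable_imp_null_set_lborel)
    then have "AE t::real in lborel. cos (2 * pi * t) \<noteq> 0"
      by (rule AE_I') auto
    then show "AE t in lborel. (\<integral>\<^sup>+p. u (rot (2 * pi * t) p) * indicator {0..1} t * indicator D (rot (2 * pi * t) p) \<partial>lborel)
      = (\<integral>\<^sup>+p. u p * indicator D p \<partial>lborel) * indicator {0..1::real} t"
    proof eventually_elim
      case (elim t)
      then show ?case
        using nn_integral_rotation[of "\<lambda>p. u p * indicator D p" "cos (2 * pi * t)" "sin (2 * pi * t)"]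
        by (auto simp: rot_def indicator_def[of "{0..1}"])
    qed
  qed
  also have "\<dots> = (\<integral>\<^sup>+p. u p * indicator D p \<partial>lborel)"
    by (simp add: nn_integral_cmult_indicator)
  also have "\<dots> \<le> (\<integral>\<^sup>+p. u p * (indicator {-1..1} (fst p) * indicator {-1..1} (snd p)) \<partial>lborel)"
  proof (intro nn_integral_mono mult_left_mono)
    fix p :: "real \<times> real"
    have "\<bar>fst p\<bar> \<le> 1 \<and> \<bar>snd p\<bar> \<le> 1" if "p \<in> D"
    proof -
      have "(fst p)\<^sup>2 \<le> 1\<^sup>2" "(snd p)\<^sup>2 \<le> 1\<^sup>2"
        using that zero_le_power2[of "fst p"] zero_le_power2[of "snd p"] unfolding D_def mem_Collect_eq power_one by linarith+
      then show ?thesis by (metis abs_le_square_iff abs_one)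
    qed
    then show "(indicator D p :: ennreal) \<le> indicator {-1..1} (fst p) * indicator {-1..1} (snd p)"
      by (auto simp: indicator_def abs_le_iff)
  qed auto
  also have "\<dots> = (\<integral>\<^sup>+y. \<integral>\<^sup>+x. u (x, y) * (indicator {-1..1} x * indicator {-1..1} y) \<partial>lborel \<partial>lborel)"
    by (subst nn_integral_lborel_pair(2)) (auto simp: borel_prod[symmetric])
  also have "\<dots> \<le> (\<integral>\<^sup>+y. ennreal (2 * M) * indicator {-1..1::real} y \<partial>lborel)"
  proof (rule nn_integral_mono)
    fix y :: real
    have "(\<integral>\<^sup>+x. u (x, y) * (indicator {-1..1} x * indicator {-1..1} y) \<partial>lborel)
      = (\<integral>\<^sup>+x. u (x, y) * indicator {-1..1} x \<partial>lborel) * indicator {-1..1} y"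
      by (simp add: nn_integral_multc flip: mult.assoc)
    also have "(\<integral>\<^sup>+x. u (x, y) * indicator {-1..1} x \<partial>lborel)
      = 2 * (\<integral>\<^sup>+t. u (-1 + 2 * t, y) * indicator {-1..1} (-1 + 2 * t) \<partial>lborel)"
      using nn_integral_real_affine[of "\<lambda>x. u (x, y) * indicator {-1..1} x" 2 "-1"] by simp
    also have "(\<integral>\<^sup>+t. u (-1 + 2 * t, y) * indicator {-1..1} (-1 + 2 * t) \<partial>lborel) = ennreal (shift_avg g (z0 + \<i> * of_real y))"
      unfolding shift_avg_nn_integral[OF g]
    proof (rule nn_integral_cong)
      fix t :: real
      have "z0 + Complex (-1 + 2 * t) y = z0 + \<i> * of_real y + of_real (2 * t - 1)"
        by (simp add: complex_eq_iff)
      moreover have "indicator {-1..1} (-1 + 2 * t) = (indicator {0..1} t :: ennreal)"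
        by (auto simp: indicator_def)
      ultimately show "u (-1 + 2 * t, y) * indicator {-1..1} (-1 + 2 * t)
        = ennreal (ln (1 + norm (g (z0 + \<i> * of_real y + of_real (2 * t - 1))))) * indicator {0..1} t"
        by (simp only: u_def fst_conv snd_conv)
    qed
    also have "2 * ennreal (shift_avg g (z0 + \<i> * of_real y)) \<le> 2 * ennreal M"
      by (intro mult_left_mono ennreal_leI M) auto
    also have "\<dots> = ennreal (2 * M)" using M0 by (simp add: ennreal_mult)
    finally show "(\<integral>\<^sup>+x. u (x, y) * (indicator {-1..1} x * indicator {-1..1} y) \<partial>lborel) \<le> ennreal (2 * M) * indicator {-1..1} y"
      by (auto simp: indicator_def)
  qed
  also have "\<dots> = ennreal (4 * M)"
    using M0 by (subst nn_integral_cmult_indicator) (auto simp: ennreal_mult[symmetric] simp flip: ennreal_numeral)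
  finally show ?thesis using M0 by (simp add: ennreal_le_iff)
qed

theorem entire_constant_if_log_plus_integrable:
  assumes hol: "g holomorphic_on UNIV" and b: "b > 0"
    and grow: "\<And>z. norm (g z) \<le> C * exp (b * (Re z)\<^sup>2)"
    and fin: "(\<integral>\<^sup>+x. ennreal (log_plus (norm (g (of_real x)))) \<partial>lborel) < \<infinity>"
  shows "g z = g 0"
proof -
  have g: "continuous_on UNIV g" using hol by (rule holomorphic_on_imp_continuous_on)
  obtain L where L: "0 \<le> L" "(\<integral>\<^sup>+x. ennreal (log_plus (norm (g (of_real x)))) \<partial>lborel) = ennreal L"
    using fin by (metis ennreal_cases infinity_ennreal_def less_irrefl)
  have C: "0 \<le> C" using order.trans[OF norm_ge_zero grow[of 0]] by simp
  \<comment> \<open>The first entry bounds the averages on the real axis. The second is the constant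
    part of the general bound, whose growth rate doubles to \<open>2 * b\<close> because
    \<open>(x + s)^2 \<le> 2 x^2 + 2\<close> for \<open>|s| \<le> 1\<close>.\<close>
  define M where "M = max (ln 2 + L) (ln (1 + C) + 2 * b)"
  have "shift_avg g z \<le> M" for z
  proof (rule shift_avg_bounded[OF hol])
    show "2 * b > 0" using b by simp
    show "shift_avg g (of_real x) \<le> M" for x
      using shift_avg_real_le[OF g L(2,1), of x] by (simp add: M_def)
    fix z
    have "norm (shift_avg g z) \<le> (ln (1 + C) + 2 * b + 2 * b * (Re z)\<^sup>2) * (1 - 0)"
      unfolding shift_avg_def
    proof (rule integral_bound)
      fix t :: real assume t: "t \<in> {0..1}"
      let ?s = "2 * t - 1"
      have "?s\<^sup>2 \<le> 1\<^sup>2" using t by (intro abs_le_square_iff[THEN iffD1]) auto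
      moreover have "0 \<le> (Re z - ?s)\<^sup>2" by simp
      ultimately have s: "(Re z + ?s)\<^sup>2 \<le> 2 + 2 * (Re z)\<^sup>2"
        unfolding power2_sum power2_diff by simp
      have "norm (g (z + of_real ?s)) \<le> C * exp (b * (Re z + ?s)\<^sup>2)"
        using grow[of "z + of_real ?s"] by simp
      also have "\<dots> \<le> C * exp (b * (2 + 2 * (Re z)\<^sup>2))"
        using s b C by (intro mult_left_mono) auto
      finally have "1 + norm (g (z + of_real ?s)) \<le> 1 * exp (b * (2 + 2 * (Re z)\<^sup>2)) + C * exp (b * (2 + 2 * (Re z)\<^sup>2))"
        using b by (intro add_mono) auto
      also have "\<dots> = (1 + C) * exp (b * (2 + 2 * (Re z)\<^sup>2))" by (simp add: algebra_simps)
      finally have "ln (1 + norm (g (z + of_real ?s))) \<le> ln ((1 + C) * exp (b * (2 + 2 * (Re z)\<^sup>2)))"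
        using C by (subst ln_le_cancel_iff) (auto simp: add_pos_nonneg)
      also have "\<dots> = ln (1 + C) + 2 * b + 2 * b * (Re z)\<^sup>2"
        using C by (subst ln_mult_pos) (auto simp: algebra_simps)
      finally show "norm (ln (1 + norm (g (z + of_real ?s)))) \<le> ln (1 + C) + 2 * b + 2 * b * (Re z)\<^sup>2"
        by simp
    qed (simp, rule continuous_on_shift[OF g])
    then show "shift_avg g z \<le> M + 2 * b * (Re z)\<^sup>2"
      by (simp add: M_def)
  qed
  then have u: "ln (1 + norm (g z)) \<le> 4 * M" for z
    by (rule ln_1_norm_le_if_shift_avg_le[OF hol])
  have "norm (g z) \<le> exp (4 * M)" for z
  proof -
    have "exp (ln (1 + norm (g z))) \<le> exp (4 * M)"
      using u[of z] by simp
    then have "1 + norm (g z) \<le> exp (4 * M)"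
      by (subst (asm) exp_ln) (auto simp: add_pos_nonneg)
    then show ?thesis by simp
  qed
  then have "bounded (range g)" by (auto simp: bounded_iff)
  from Liouville_theorem[OF hol this] show ?thesis
    by (auto simp: constant_on_def)
qed

section \<open>Gaussian integrals and the Borel form of condition (A)\<close>

text \<open>Since \<open>u\<close> squares to \<open>- 1\<close>, the map \<open>h\<close> sending
  \<open>\<i>\<close> to \<open>u\<close> is a bounded real-linear ring homomorphism from the
  complex numbers; it carries the exponential series of \<open>\<i> t\<close> termwise to that of
  \<open>t *\<^sub>R u\<close>.\<close>

lemma exp_scaleR_imaginary_unit:
  fixes u :: quat
  assumes u: "u * u = - 1"
  shows "exp (t *\<^sub>R u) = of_real (cos t) + sin t *\<^sub>R u"
proof -
  define h where "h z = of_real (Re z) + Im z *\<^sub>R u" for z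
  have lin: "bounded_linear h"
    unfolding h_def of_real_def
    by (intro bounded_linear_add bounded_linear_compose[OF bounded_linear_scaleR_left] bounded_linear_Re bounded_linear_Im)
  have mult: "h (z * w) = h z * h w" for z w
    by (simp add: h_def of_real_def algebra_simps u)
  have power: "h (z ^ n) = h z ^ n" for z n
    by (induction n) (simp_all add: mult, simp add: h_def)
  have "h (exp (\<i> * of_real t)) = (\<Sum>n. h ((\<i> * of_real t) ^ n /\<^sub>R fact n))"
    unfolding exp_def by (rule bounded_linear.suminf[OF lin summable_exp_generic])
  also have "\<dots> = exp (h (\<i> * of_real t))"
    unfolding exp_def by (simp add: linear_scale[OF bounded_linear.linear[OF lin]] power)
  also have "h (\<i> * of_real t) = t *\<^sub>R u" by (simp add: h_def)
  also have "exp (\<i> * of_real t) = cis t" by (simp add: cis_conv_exp)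
  finally show ?thesis by (simp add: h_def)
qed

lemma exp_qi: "exp (- (t *\<^sub>R qi)) = Quat (cos t) (- sin t) 0 0"
  using exp_scaleR_imaginary_unit[OF quat_unit_mult(1), of "- t"]
  by (simp add: of_real_def qi_def one_quat_def scaleR_quat_def plus_quat_def uminus_quat_def)

lemma exp_qj: "exp (- (t *\<^sub>R qj)) = Quat (cos t) 0 (- sin t) 0"
  using exp_scaleR_imaginary_unit[OF quat_unit_mult(2), of "- t"]
  by (simp add: of_real_def qj_def one_quat_def scaleR_quat_def plus_quat_def uminus_quat_def)

lemma norm_exp_qi [simp]: "norm (exp (- (t *\<^sub>R qi))) = 1"
  and norm_exp_qj [simp]: "norm (exp (- (t *\<^sub>R qj))) = 1"
  by (simp_all add: exp_qi exp_qj norm_quat_def)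

lemma has_bochner_integral_gaussian_iexp:
  fixes a \<xi> :: real
  assumes a: "a > 0"
  shows "has_bochner_integral lborel (\<lambda>x. exp (- a * x\<^sup>2) *\<^sub>R cis (2 * pi * \<xi> * x))
    (of_real (sqrt (pi / a) * exp (- (pi\<^sup>2 * \<xi>\<^sup>2 / a))))"
proof -
  \<comment> \<open>Scaling by \<open>c\<close> turns \<open>exp (- y^2 / 2)\<close> into
    \<open>exp (- a x^2)\<close>, and \<open>t\<close> is the frequency with
    \<open>t c = 2 pi \<xi>\<close>. The value is then read off from the characteristic function of
    the standard normal law.\<close>
  define c where "c = sqrt (2 * a)"
  define t where "t = 2 * pi * \<xi> / c"
  have c: "c > 0" "c\<^sup>2 = 2 * a" using a by (auto simp: c_def)
  have int: "integrable lborel (\<lambda>x. std_normal_density x *\<^sub>R cis (t * x))"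
    by (rule Bochner_Integration.integrable_bound[OF integrable_normal_density[where \<mu> = 0 and \<sigma> = 1]]) (auto simp: cis_conv_exp)
  have "(\<integral>x. std_normal_density x *\<^sub>R cis (t * x) \<partial>lborel) = char std_normal_distribution t"
    unfolding char_def by (subst integral_density) (auto simp: cis_conv_exp)
  also have "\<dots> = of_real (exp (- t\<^sup>2 / 2))"
    by (simp add: char_std_normal_distribution)
  finally have "has_bochner_integral lborel (\<lambda>x. std_normal_density x *\<^sub>R cis (t * x)) (of_real (exp (- t\<^sup>2 / 2)))"
    using int by (simp add: has_bochner_integral_iff)
  then have "has_bochner_integral lborel (\<lambda>x. std_normal_density (0 + c * x) *\<^sub>R cis (t * (0 + c * x)))
      (of_real (exp (- t\<^sup>2 / 2)) /\<^sub>R \<bar>c\<bar>)"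
    using lborel_has_bochner_integral_real_affine_iff[of c "\<lambda>x. std_normal_density x *\<^sub>R cis (t * x)" _ 0] c by simp
  then have "has_bochner_integral lborel (\<lambda>x. sqrt (2 * pi) *\<^sub>R (std_normal_density (0 + c * x) *\<^sub>R cis (t * (0 + c * x))))
      (sqrt (2 * pi) *\<^sub>R (of_real (exp (- t\<^sup>2 / 2)) /\<^sub>R \<bar>c\<bar>))"
    by (rule has_bochner_integral_scaleR_right)
  also have "(\<lambda>x. sqrt (2 * pi) *\<^sub>R (std_normal_density (0 + c * x) *\<^sub>R cis (t * (0 + c * x))))
      = (\<lambda>x. exp (- a * x\<^sup>2) *\<^sub>R cis (2 * pi * \<xi> * x))"
    using c by (intro ext) (simp add: std_normal_density_def power_mult_distrib t_def mult.assoc)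
  also have "sqrt (2 * pi) *\<^sub>R (of_real (exp (- t\<^sup>2 / 2)) /\<^sub>R \<bar>c\<bar>) = complex_of_real (sqrt (pi / a) * exp (- (pi\<^sup>2 * \<xi>\<^sup>2 / a)))"
  proof -
    have "t\<^sup>2 = (2 * pi * \<xi>)\<^sup>2 / (2 * a)"
      unfolding t_def power_divide c(2) ..
    then have "- t\<^sup>2 / 2 = - (pi\<^sup>2 * \<xi>\<^sup>2 / a)"
      by (simp add: power_mult_distrib)
    moreover have "sqrt (2 * pi) / c = sqrt (pi / a)"
      by (simp add: c_def real_sqrt_divide[symmetric])
    ultimately have "sqrt (2 * pi) * (inverse c * exp (- t\<^sup>2 / 2)) = sqrt (pi / a) * exp (- (pi\<^sup>2 * \<xi>\<^sup>2 / a))"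
      by (simp only: mult.assoc[symmetric] divide_inverse)
    then show ?thesis
      using c(1) by (simp only: scaleR_conv_of_real of_real_mult[symmetric] abs_of_pos)
  qed
  finally show ?thesis .
qed

lemma integrable_gaussian: "a > 0 \<Longrightarrow> integrable lborel (\<lambda>x::real. exp (- a * x\<^sup>2))"
  using has_bochner_integral_gaussian_iexp[of a 0] integrable_norm[of lborel "\<lambda>x. exp (- a * x\<^sup>2) *\<^sub>R cis 0"]
  by (auto simp: has_bochner_integral_iff)

lemma gaussian_cos_integral:
  assumes a: "a > 0"
  shows "has_bochner_integral lborel (\<lambda>x. exp (- a * x\<^sup>2) * cos (2 * pi * \<xi> * x)) (sqrt (pi / a) * exp (- (pi\<^sup>2 * \<xi>\<^sup>2 / a)))"
    and gaussian_sin_integral: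
      "has_bochner_integral lborel (\<lambda>x. exp (- a * x\<^sup>2) * sin (2 * pi * \<xi> * x)) 0"
  using has_bochner_integral_bounded_linear[OF bounded_linear_Re has_bochner_integral_gaussian_iexp[OF a, of \<xi>]]
    has_bochner_integral_bounded_linear[OF bounded_linear_Im has_bochner_integral_gaussian_iexp[OF a, of \<xi>]]
  by simp_all

section \<open>Plane integrals, Borel representatives and exponential moments\<close>

lemma norm_prod_power2: "(norm (x :: real \<times> real))\<^sup>2 = (fst x)\<^sup>2 + (snd x)\<^sup>2"
  by (simp add: norm_prod_def)

lemma integrable_lborel_prod_mult:
  fixes f :: "real \<Rightarrow> real" and g :: "real \<Rightarrow> real"
  assumes "integrable lborel f" "integrable lborel g"
  shows "integrable lborel (\<lambda>x. f (fst x) * g (snd x))"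
proof -
  have "integrable (lborel \<Otimes>\<^sub>M lborel) (\<lambda>x. f (fst x) * g (snd x))"
  proof (rule lborel_pair.Fubini_integrable)
    have [measurable]: "f \<in> borel_measurable borel" "g \<in> borel_measurable borel"
      using assms[THEN borel_measurable_integrable] by simp_all
    show "(\<lambda>x. f (fst x) * g (snd x)) \<in> borel_measurable (lborel \<Otimes>\<^sub>M lborel)"
      by measurable
    have "integrable lborel (\<lambda>x. \<bar>f x\<bar> * (\<integral>y. \<bar>g y\<bar> \<partial>lborel))"
      by (intro integrable_mult_left integrable_abs assms)
    then show "integrable lborel (\<lambda>x. \<integral>y. norm (f (fst (x, y)) * g (snd (x, y))) \<partial>lborel)"
      by (simp add: abs_mult)
    show "AE x in lborel. integrable lborel (\<lambda>y. f (fst (x, y)) * g (snd (x, y)))"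
      by (rule AE_I2) (simp add: assms(2))
  qed
  then show ?thesis by (simp add: lborel_prod)
qed

lemma integrable_gaussian_plane:
  assumes "a > 0"
  shows "integrable lborel (\<lambda>x::real \<times> real. exp (- a * (norm x)\<^sup>2))"
  using integrable_lborel_prod_mult[OF integrable_gaussian[OF assms] integrable_gaussian[OF assms]]
  by (simp add: norm_prod_power2 mult_exp_exp distrib_left)

lemma lborel_integral_translate:
  fixes f :: "'a::euclidean_space \<Rightarrow> 'b::euclidean_space"
  assumes "integrable lborel f"
  shows "integrable lborel (\<lambda>x. f (v + x))" and "(\<integral>x. f (v + x) \<partial>lborel) = (\<integral>x. f x \<partial>lborel)"
proof -
  have [measurable]: "f \<in> borel_measurable borel" using assms by simp
  show "integrable lborel (\<lambda>x. f (v + x))"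
    using assms lborel_distr_plus[of v] integrable_distr_eq[of "(+) v" lborel borel f] by simp
  show "(\<integral>x. f (v + x) \<partial>lborel) = (\<integral>x. f x \<partial>lborel)"
    using lborel_distr_plus[of v] integral_distr[of "(+) v" lborel borel f] by simp
qed

lemma completion_ex_borel_measurable_euclidean:
  fixes f :: "'a \<Rightarrow> 'b::euclidean_space"
  assumes f: "f \<in> borel_measurable (completion M)"
  shows "\<exists>f'\<in>borel_measurable M. AE x in M. f x = f' x"
proof -
  have "\<exists>g. g \<in> borel_measurable M \<and> (AE x in M. f x \<bullet> b = g x)" for b
    unfolding Bex_def[symmetric]
    by (intro completion_ex_borel_measurable_real borel_measurable_inner f) simp
  then have "\<exists>g. \<forall>b. g b \<in> borel_measurable M \<and> (AE x in M. f x \<bullet> b = g b x)"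
    by (intro choice allI)
  then obtain g where g [measurable]: "\<And>b. g b \<in> borel_measurable M"
    and ae: "\<And>b. AE x in M. f x \<bullet> b = g b x"
    by blast
  have "AE x in M. \<forall>b\<in>Basis. f x \<bullet> b = g b x"
    by (rule AE_finite_allI[OF finite_Basis ae])
  then have "AE x in M. f x = (\<Sum>b\<in>Basis. g b x *\<^sub>R b)"
  proof eventually_elim
    case (elim x)
    then have "(\<Sum>b\<in>Basis. g b x *\<^sub>R b) = (\<Sum>b\<in>Basis. (f x \<bullet> b) *\<^sub>R b)"
      by (intro sum.cong) simp_all
    then show ?case by (simp only: euclidean_representation)
  qed
  moreover have "(\<lambda>x. \<Sum>b\<in>Basis. g b x *\<^sub>R b) \<in> borel_measurable M" by measurable
  ultimately show ?thesis by (rule bexI)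
qed

text \<open>A pointwise form of (A): \<open>w\<close> plays the norm of the integrable summand and
  \<open>M\<close> the bound of the other one. Borel measurability and a bound at every point permit
  slicing by Fubini. The bound sees only the norm of \<open>f\<close>, so multiplication by
  measurable unit quaternions preserves the property.\<close>

definition gauss_dominated :: "real \<Rightarrow> (real \<times> real \<Rightarrow> quat) \<Rightarrow> bool" where
  "gauss_dominated a f \<longleftrightarrow> f \<in> borel_measurable borel \<and>
     (\<exists>w M. integrable lborel w \<and> (\<forall>x. 0 \<le> w x) \<and> 0 \<le> M \<and>
       (\<forall>x. norm (f x) \<le> exp (- a * (norm x)\<^sup>2) * (w x + M)))"

lemma condition_A_gauss_dominated:
  assumes "condition_A a f"
  shows "\<exists>f'. gauss_dominated a f' \<and> (AE x in lebesgue. f x = f' x)"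
proof -
  obtain f1 f2 M where f1: "f1 \<in> borel_measurable lebesgue" "integrable lebesgue (\<lambda>x. norm (f1 x))"
    and f2: "f2 \<in> borel_measurable lebesgue" "AE x in lebesgue. norm (f2 x) \<le> M"
    and f: "(\<lambda>x. exp (a * (norm x)\<^sup>2) *\<^sub>R f x) = (\<lambda>x. f1 x + f2 x)"
    using assms unfolding condition_A_def L1_plus_Linf_quat_def L1_quat_def Linf_quat_def by blast
  obtain g1 where [measurable]: "g1 \<in> borel_measurable borel" and g1: "AE x in lborel. f1 x = g1 x"
    using completion_ex_borel_measurable_euclidean[OF f1(1)] by auto
  obtain g2 where [measurable]: "g2 \<in> borel_measurable borel" and g2: "AE x in lborel. f2 x = g2 x"
    using completion_ex_borel_measurable_euclidean[OF f2(1)] by auto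
  have int: "integrable lborel (\<lambda>x. norm (g1 x))"
  proof -
    have "AE x in lebesgue. norm (f1 x) = norm (g1 x)"
      using g1 by (intro AE_completion) auto
    then have "integrable lebesgue (\<lambda>x. norm (g1 x))"
      using f1 by (subst integrable_cong_AE[where g = "\<lambda>x. norm (f1 x)"]) (auto simp: eq_commute intro: measurable_completion)
    then show ?thesis by (subst (asm) integrable_completion) auto
  qed
  \<comment> \<open>Setting \<open>h\<close> to 0 where \<open>g2\<close> exceeds its essential
    bound turns an almost everywhere estimate into one valid everywhere;
    \<open>\<bar>M\<bar>\<close> supplies a nonnegative constant.\<close>
  define h where "h x = (if norm (g2 x) \<le> \<bar>M\<bar> then exp (- a * (norm x)\<^sup>2) *\<^sub>R (g1 x + g2 x) else 0)" for x
  have "gauss_dominated a h"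
    unfolding gauss_dominated_def
  proof (intro conjI exI[of _ "\<lambda>x. norm (g1 x)"] exI[of _ "\<bar>M\<bar>"] allI int)
    show "h \<in> borel_measurable borel" unfolding h_def by measurable
    show "norm (h x) \<le> exp (- a * (norm x)\<^sup>2) * (norm (g1 x) + \<bar>M\<bar>)" for x
      unfolding h_def by (auto intro!: mult_left_mono order.trans[OF norm_triangle_ineq] mult_nonneg_nonneg)
  qed auto
  moreover have "AE x in lebesgue. f x = h x"
    using AE_completion[OF g1] AE_completion[OF g2] f2(2)
  proof eventually_elim
    case (elim x)
    have "exp (- a * (norm x)\<^sup>2) *\<^sub>R (exp (a * (norm x)\<^sup>2) *\<^sub>R f x) = exp (- a * (norm x)\<^sup>2) *\<^sub>R (f1 x + f2 x)"
      using fun_cong[OF f, of x] by (simp only:)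
    with elim show ?case by (auto simp: h_def exp_minus)
  qed
  ultimately show ?thesis by blast
qed

text \<open>Completing the square: \<open>2 pi \<eta> (x \<bullet> e) - a |x|^2\<close> equals
  \<open>pi^2 \<eta>^2 / a - a |v + x|^2\<close>. The shifted Gaussian is at most 1 against
  \<open>w\<close>, and against \<open>M\<close> its integral is independent of the shift. So
  \<open>C\<close> depends on neither \<open>\<eta>\<close> nor \<open>e\<close>, and the rate is
  exactly \<open>pi^2 / a\<close>.\<close>

lemma gauss_dominated_exp_moment:
  assumes dom: "gauss_dominated a f" and a: "a > 0"
  obtains C where "0 \<le> C" and
    "\<And>\<eta> e. norm e = 1 \<Longrightarrow> integrable lborel (\<lambda>x. exp (2 * pi * \<eta> * (x \<bullet> e)) * norm (f x))"
    "\<And>\<eta> e. norm e = 1 \<Longrightarrow> (\<integral>x. exp (2 * pi * \<eta> * (x \<bullet> e)) * norm (f x) \<partial>lborel) \<le> C * exp (pi\<^sup>2 / a * \<eta>\<^sup>2)"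
proof -
  obtain w M where f [measurable]: "f \<in> borel_measurable borel"
    and w: "integrable lborel w" "\<And>x. 0 \<le> w x" and M: "0 \<le> M"
    and le: "\<And>x. norm (f x) \<le> exp (- a * (norm x)\<^sup>2) * (w x + M)"
    using dom unfolding gauss_dominated_def by blast
  let ?G = "\<lambda>x::real \<times> real. exp (- a * (norm x)\<^sup>2)"
  define C where "C = (\<integral>x. w x \<partial>lborel) + M * (\<integral>x. ?G x \<partial>lborel)"
  have C0: "0 \<le> C" unfolding C_def using w M by (intro add_nonneg_nonneg mult_nonneg_nonneg integral_nonneg) auto
  have main: "integrable lborel (\<lambda>x. exp (2 * pi * \<eta> * (x \<bullet> e)) * norm (f x)) \<and>
    (\<integral>x. exp (2 * pi * \<eta> * (x \<bullet> e)) * norm (f x) \<partial>lborel) \<le> C * exp (pi\<^sup>2 / a * \<eta>\<^sup>2)"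
    if e: "norm e = 1" for \<eta> e
  proof -
    define v where "v = (- (pi * \<eta> / a)) *\<^sub>R e"
    define B where "B x = exp (pi\<^sup>2 / a * \<eta>\<^sup>2) * (w x + M * ?G (v + x))" for x
    have B: "integrable lborel B" "(\<integral>x. B x \<partial>lborel) = C * exp (pi\<^sup>2 / a * \<eta>\<^sup>2)"
      unfolding B_def C_def using w lborel_integral_translate[OF integrable_gaussian_plane[OF a], of v] by simp_all
    have bound: "exp (2 * pi * \<eta> * (x \<bullet> e)) * norm (f x) \<le> B x" for x
    proof -
      have "2 * pi * \<eta> * (x \<bullet> e) - a * (norm x)\<^sup>2 = pi\<^sup>2 / a * \<eta>\<^sup>2 - a * (norm (v + x))\<^sup>2"
      proof -
        have "(norm (v + x))\<^sup>2 = (pi * \<eta> / a)\<^sup>2 - 2 * (pi * \<eta> / a) * (x \<bullet> e) + (norm x)\<^sup>2"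
          using e unfolding power2_norm_eq_inner v_def
          by (simp add: inner_add_left inner_add_right inner_diff_left inner_diff_right norm_eq_sqrt_inner inner_commute power2_eq_square)
        then show ?thesis using a by (simp add: field_simps power2_eq_square)
      qed
      then have eq: "exp (2 * pi * \<eta> * (x \<bullet> e)) * ?G x = exp (pi\<^sup>2 / a * \<eta>\<^sup>2) * ?G (v + x)"
        unfolding exp_add[symmetric] by simp
      have "exp (2 * pi * \<eta> * (x \<bullet> e)) * norm (f x) \<le> exp (2 * pi * \<eta> * (x \<bullet> e)) * (?G x * (w x + M))"
        by (intro mult_left_mono le) auto
      also have "\<dots> = exp (pi\<^sup>2 / a * \<eta>\<^sup>2) * (?G (v + x) * w x + M * ?G (v + x))"
        unfolding mult.assoc[symmetric] eq by (simp add: algebra_simps)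
      also have "\<dots> \<le> B x"
        unfolding B_def using a w(2)[of x] by (intro mult_left_mono add_right_mono mult_left_le_one_le) auto
      finally show ?thesis .
    qed
    have "integrable lborel (\<lambda>x. exp (2 * pi * \<eta> * (x \<bullet> e)) * norm (f x))"
      by (rule Bochner_Integration.integrable_bound[OF B(1)])
        (auto intro!: order.trans[OF bound abs_ge_self])
    then show ?thesis using integral_mono[OF _ B(1) bound] B(2) by simp
  qed
  show ?thesis by (rule that[OF C0]) (simp_all only: main)
qed

lemma gauss_dominated_integrable:
  assumes "gauss_dominated a f" "a > 0"
  shows "integrable lborel f"
proof -
  obtain C where "\<And>\<eta> e. norm e = 1 \<Longrightarrow> integrable lborel (\<lambda>x. exp (2 * pi * \<eta> * (x \<bullet> e)) * norm (f x))"
    using gauss_dominated_exp_moment[OF assms] by metis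
  from this[of "(1, 0)" 0] have "integrable lborel (\<lambda>x. norm (f x))" by simp
  then show ?thesis
    using assms by (subst (asm) integrable_norm_iff) (auto simp: gauss_dominated_def)
qed

section \<open>Fourier integrals as entire functions\<close>

text \<open>Expanding the exponential and integrating termwise gives a power series convergent
  everywhere. All partial sums are dominated through
  \<open>exp (|w| |p|) \<le> exp (|w| p) + exp (- |w| p)\<close>, so real exponential moments of
  both signs suffice.\<close>

lemma holomorphic_exp_integral:
  fixes a :: "'a \<Rightarrow> complex" and p :: "'a \<Rightarrow> real"
  assumes [measurable]: "p \<in> borel_measurable M" "a \<in> borel_measurable M"
    and int: "\<And>\<eta>. integrable M (\<lambda>x. exp (\<eta> * p x) * norm (a x))"
  shows "(\<lambda>z. \<integral>x. exp (z * of_real (p x)) * a x \<partial>M) holomorphic_on UNIV"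
proof -
  let ?\<Phi> = "\<lambda>z. \<integral>x. exp (z * of_real (p x)) * a x \<partial>M"
  define c where "c n = (\<integral>x. (of_real (p x) ^ n /\<^sub>R fact n) * a x \<partial>M)" for n
  have "(\<lambda>n. c n * (w - 0) ^ n) sums ?\<Phi> w" for w
  proof -
    let ?f = "\<lambda>n x. ((w * of_real (p x)) ^ n /\<^sub>R fact n) * a x"
    let ?B = "\<lambda>x. exp (norm w * p x) * norm (a x) + exp (- norm w * p x) * norm (a x)"
    have B: "integrable M ?B"
      by (intro Bochner_Integration.integrable_add int)
    have norm_f: "norm (?f n x) = ((norm w * \<bar>p x\<bar>) ^ n / fact n) * norm (a x)" for n x
      by (simp add: norm_mult norm_power divide_inverse mult.commute)
    have exp_le: "exp (norm w * \<bar>p x\<bar>) * norm (a x) \<le> ?B x" for x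
      by (cases "p x \<ge> 0") auto
    have sum_le: "(\<Sum>n<N. norm (?f n x)) \<le> ?B x" for N x
    proof -
      have "(\<Sum>n<N. (norm w * \<bar>p x\<bar>) ^ n / fact n) \<le> exp (norm w * \<bar>p x\<bar>)"
        using sum_le_suminf[OF summable_exp_generic[of "norm w * \<bar>p x\<bar>"], of "{..<N}"]
        by (simp add: exp_def divide_inverse mult.commute)
      then have "(\<Sum>n<N. (norm w * \<bar>p x\<bar>) ^ n / fact n) * norm (a x) \<le> exp (norm w * \<bar>p x\<bar>) * norm (a x)"
        by (rule mult_right_mono) simp
      then show ?thesis
        unfolding norm_f sum_distrib_right[symmetric] using exp_le[of x] by linarith
    qed
    have f_le: "norm (?f n x) \<le> ?B x" for n x
      using sum_le[where N = "Suc n" and x = x] sum_nonneg[of "{..<n}" "\<lambda>n. norm (?f n x)"] by simp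
    have f_int: "integrable M (?f n)" for n
    proof (rule Bochner_Integration.integrable_bound[OF B])
      show "AE x in M. norm (?f n x) \<le> norm (?B x)"
        unfolding real_norm_def by (intro AE_I2 order.trans[OF f_le abs_ge_self])
    qed measurable
    have "(\<lambda>n. integral\<^sup>L M (?f n)) sums (\<integral>x. (\<Sum>n. ?f n x) \<partial>M)"
    proof (rule sums_integral[OF f_int])
      show "AE x in M. summable (\<lambda>n. norm (?f n x))"
        by (intro AE_I2 summableI_nonneg_bounded[OF _ sum_le]) simp
      show "summable (\<lambda>n. \<integral>x. norm (?f n x) \<partial>M)"
      proof (rule summableI_nonneg_bounded)
        fix N
        have "(\<Sum>n<N. \<integral>x. norm (?f n x) \<partial>M) = (\<integral>x. (\<Sum>n<N. norm (?f n x)) \<partial>M)"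
          by (rule Bochner_Integration.integral_sum[symmetric]) (intro integrable_norm f_int)
        also have "\<dots> \<le> (\<integral>x. ?B x \<partial>M)"
          by (intro integral_mono B sum_le Bochner_Integration.integrable_sum integrable_norm f_int)
        finally show "(\<Sum>n<N. \<integral>x. norm (?f n x) \<partial>M) \<le> (\<integral>x. ?B x \<partial>M)" .
      qed (rule Bochner_Integration.integral_nonneg, simp)
    qed
    moreover have "(\<Sum>n. ?f n x) = exp (w * of_real (p x)) * a x" for x
      unfolding exp_def by (rule suminf_mult2[symmetric]) (rule summable_exp_generic)
    moreover have "integral\<^sup>L M (?f n) = c n * w ^ n" for n
    proof -
      have "?f n = (\<lambda>x. w ^ n * ((of_real (p x) ^ n /\<^sub>R fact n) * a x))"
        by (simp add: power_mult_distrib mult_ac)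
      then show ?thesis by (simp only: c_def integral_mult_right_zero mult.commute)
    qed
    ultimately show ?thesis by simp
  qed
  then have hol: "?\<Phi> holomorphic_on ball 0 r" for r
    by (intro power_series_holomorphic) auto
  show ?thesis
    unfolding holomorphic_on_def
  proof
    fix z :: complex
    have "?\<Phi> field_differentiable at z"
      using hol[of "norm z + 1"] by (rule holomorphic_on_imp_differentiable_at) auto
    then show "?\<Phi> field_differentiable at z within UNIV" by simp
  qed
qed

text \<open>\<open>T\<close> is to be a complex coordinate of the quaternions and \<open>e\<close>
  the direction whose frequency is continued. That \<open>T\<close> does not increase norms lets the
  moment bound for \<open>H\<close> pass to \<open>T (H x)\<close>. The conclusion is constancy of
  \<open>g\<close>, read off at \<open>\<xi>\<close> and at 0.\<close>

lemma fourier_component_gaussian: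
  fixes T :: "quat \<Rightarrow> complex"
  assumes a: "a > 0" and dom: "gauss_dominated a H" and e: "norm e = 1"
    and T: "bounded_linear T" "\<And>q. norm (T q) \<le> norm q"
    and Q: "\<And>\<xi>. Q \<xi> = (\<integral>x. cis (- (2 * pi * \<xi> * (x \<bullet> e))) * T (H x) \<partial>lborel)"
    and \<rho>: "\<rho> > 0"
    and fin: "(\<integral>\<^sup>+\<xi>. ennreal (log_plus (exp (pi\<^sup>2 / a * \<xi>\<^sup>2) * norm (Q \<xi>) / \<rho>)) \<partial>lborel) < \<infinity>"
  shows "of_real (exp (pi\<^sup>2 / a * \<xi>\<^sup>2)) * Q \<xi> = Q 0"
proof -
  obtain C where C: "0 \<le> C"
    and int: "\<And>\<eta> e. norm e = 1 \<Longrightarrow> integrable lborel (\<lambda>x. exp (2 * pi * \<eta> * (x \<bullet> e)) * norm (H x))"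
    and le: "\<And>\<eta> e. norm e = 1 \<Longrightarrow> (\<integral>x. exp (2 * pi * \<eta> * (x \<bullet> e)) * norm (H x) \<partial>lborel) \<le> C * exp (pi\<^sup>2 / a * \<eta>\<^sup>2)"
    using gauss_dominated_exp_moment[OF dom a] by blast
  have H [measurable]: "H \<in> borel_measurable borel" using dom by (simp add: gauss_dominated_def)
  have "continuous_on UNIV T" using T(1) by (rule linear_continuous_on)
  then have TH [measurable]: "(\<lambda>x. T (H x)) \<in> borel_measurable borel"
    by (intro measurable_compose[OF H] borel_measurable_continuous_onI)
  have intT: "integrable lborel (\<lambda>x. exp (2 * pi * \<eta> * (x \<bullet> e)) * norm (T (H x)))" for \<eta>
    by (rule Bochner_Integration.integrable_bound[OF int[OF e, of \<eta>]]) (auto intro!: mult_left_mono T(2))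
  define \<Phi> where "\<Phi> z = (\<integral>x. exp (z * of_real (x \<bullet> e)) * T (H x) \<partial>lborel)" for z
  have "\<Phi> holomorphic_on UNIV"
    unfolding \<Phi>_def
  proof (rule holomorphic_exp_integral)
    show "integrable lborel (\<lambda>x. exp (\<eta> * (x \<bullet> e)) * norm (T (H x)))" for \<eta>
      using intT[of "\<eta> / (2 * pi)"] by simp
  qed simp_all
  then have \<Phi>hol: "(\<lambda>z. \<Phi> (- (2 * of_real pi * \<i> * z))) holomorphic_on UNIV"
    by (rule holomorphic_compose_UNIV) (intro holomorphic_intros)
  have Q\<Phi>: "Q \<xi> = \<Phi> (- (2 * of_real pi * \<i> * of_real \<xi>))" for \<xi>
  proof -
    have "cis (- (2 * pi * \<xi> * (x \<bullet> e))) = exp (- (2 * of_real pi * \<i> * of_real \<xi>) * of_real (x \<bullet> e))" for x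
      unfolding cis_conv_exp by (rule arg_cong[of _ _ exp]) simp
    then show ?thesis unfolding Q \<Phi>_def by simp
  qed
  have \<Phi>le: "norm (\<Phi> (- (2 * of_real pi * \<i> * z))) \<le> C * exp (pi\<^sup>2 / a * (Im z)\<^sup>2)" for z
  proof -
    have "norm (\<Phi> (- (2 * of_real pi * \<i> * z))) \<le> (\<integral>x. exp (2 * pi * Im z * (x \<bullet> e)) * norm (H x) \<partial>lborel)"
      unfolding \<Phi>_def
    proof (rule Bochner_Integration.integral_norm_bound_integral)
      have n: "norm (exp (- (2 * of_real pi * \<i> * z) * of_real (x \<bullet> e)) * T (H x)) = exp (2 * pi * Im z * (x \<bullet> e)) * norm (T (H x))" for x
        by (simp add: norm_mult)
      show "integrable lborel (\<lambda>x. exp (- (2 * of_real pi * \<i> * z) * of_real (x \<bullet> e)) * T (H x))"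
        by (rule Bochner_Integration.integrable_bound[OF intT[of "Im z"]]) (auto simp: norm_mult)
      show "norm (exp (- (2 * of_real pi * \<i> * z) * of_real (x \<bullet> e)) * T (H x)) \<le> exp (2 * pi * Im z * (x \<bullet> e)) * norm (H x)" for x
        unfolding n by (intro mult_left_mono T(2)) simp
    qed (rule int[OF e])
    also note le[OF e]
    finally show ?thesis .
  qed
  \<comment> \<open>On the real line this is the transform times the Gaussian weight over the
    threshold, hence the quantity inside \<open>log_plus\<close>.\<close>
  define g where "g z = \<Phi> (- (2 * of_real pi * \<i> * z)) * exp (of_real (pi\<^sup>2 / a) * z\<^sup>2) / of_real \<rho>" for z
  have greal: "g (of_real \<xi>) = of_real (exp (pi\<^sup>2 / a * \<xi>\<^sup>2)) * Q \<xi> / of_real \<rho>" for \<xi>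
    unfolding g_def Q\<Phi> by (simp flip: exp_of_real)
  have "g (of_real \<xi>) = g 0"
  proof (rule entire_constant_if_log_plus_integrable)
    show "g holomorphic_on UNIV"
      unfolding g_def using \<rho> by (intro holomorphic_intros \<Phi>hol) simp
    show "pi\<^sup>2 / a > 0" using a by simp
    show "norm (g z) \<le> C / \<rho> * exp (pi\<^sup>2 / a * (Re z)\<^sup>2)" for z
    proof -
      have "Re (of_real (pi\<^sup>2 / a) * z\<^sup>2) = pi\<^sup>2 / a * ((Re z)\<^sup>2 - (Im z)\<^sup>2)"
        by (simp only: Re_complex_of_real Im_complex_of_real times_complex.sel power2_eq_square)
      then have "norm (g z) = norm (\<Phi> (- (2 * of_real pi * \<i> * z))) * exp (pi\<^sup>2 / a * ((Re z)\<^sup>2 - (Im z)\<^sup>2)) / \<rho>"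
        using \<rho> unfolding g_def norm_divide norm_mult norm_exp_eq_Re by (simp only: norm_of_real abs_of_pos)
      also have "\<dots> \<le> C * exp (pi\<^sup>2 / a * (Im z)\<^sup>2) * exp (pi\<^sup>2 / a * ((Re z)\<^sup>2 - (Im z)\<^sup>2)) / \<rho>"
        using \<rho> by (intro divide_right_mono mult_right_mono \<Phi>le) auto
      also have "\<dots> = C / \<rho> * exp (pi\<^sup>2 / a * (Re z)\<^sup>2)"
        by (simp add: mult.assoc mult_exp_exp algebra_simps)
      finally show ?thesis .
    qed
    have "norm (g (of_real \<xi>)) = exp (pi\<^sup>2 / a * \<xi>\<^sup>2) * norm (Q \<xi>) / \<rho>" for \<xi>
      unfolding greal using \<rho> by (simp add: norm_mult norm_divide)
    then show "(\<integral>\<^sup>+\<xi>. ennreal (log_plus (norm (g (of_real \<xi>)))) \<partial>lborel) < \<infinity>"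
      using fin by simp
  qed
  then have "g (of_real \<xi>) = g (of_real 0)" by simp
  then show ?thesis
    unfolding greal using \<rho> by simp
qed

section \<open>The transform of a function satisfying both conditions\<close>

lemma exp_qi_scaleR: "exp (- (t *\<^sub>R qi)) = cos t *\<^sub>R 1 - sin t *\<^sub>R qi"
  and exp_qj_scaleR: "exp (- (t *\<^sub>R qj)) = cos t *\<^sub>R 1 - sin t *\<^sub>R qj"
  unfolding exp_qi exp_qj by (simp_all add: qi_def qj_def one_quat_def scaleR_quat_def minus_quat_def)

lemma continuous_on_exp_qi [continuous_intros]:
  fixes f :: "'a::t2_space \<Rightarrow> real"
  shows "continuous_on S f \<Longrightarrow> continuous_on S (\<lambda>x. exp (- (f x *\<^sub>R qi)))"
  and continuous_on_exp_qj [continuous_intros]: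
  "continuous_on S f \<Longrightarrow> continuous_on S (\<lambda>x. exp (- (f x *\<^sub>R qj)))"
  unfolding exp_qi_scaleR exp_qj_scaleR by (auto intro!: continuous_intros)

lemma tendsto_exp_qi [tendsto_intros]:
  fixes f :: "'a::t2_space \<Rightarrow> real"
  shows "(f \<longlongrightarrow> t) F \<Longrightarrow> ((\<lambda>x. exp (- (f x *\<^sub>R qi))) \<longlongrightarrow> exp (- (t *\<^sub>R qi))) F"
  and tendsto_exp_qj [tendsto_intros]:
  "(f \<longlongrightarrow> t) F \<Longrightarrow> ((\<lambda>x. exp (- (f x *\<^sub>R qj))) \<longlongrightarrow> exp (- (t *\<^sub>R qj))) F"
  unfolding exp_qi_scaleR exp_qj_scaleR by (auto intro!: tendsto_intros)

lemma borel_measurable_exp_qi [measurable]: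
  "f \<in> borel_measurable M \<Longrightarrow> (\<lambda>x. exp (- (f x *\<^sub>R qi))) \<in> borel_measurable M"
  and borel_measurable_exp_qj [measurable]:
  "f \<in> borel_measurable M \<Longrightarrow> (\<lambda>x. exp (- (f x *\<^sub>R qj))) \<in> borel_measurable M"
  by (erule measurable_compose[OF _ borel_measurable_continuous_onI]; intro continuous_intros)+

definition qft_kernel :: "real \<times> real \<Rightarrow> real \<times> real \<Rightarrow> quat \<Rightarrow> quat" where
  "qft_kernel \<xi> x q = exp (- ((2 * pi * fst \<xi> * fst x) *\<^sub>R qi)) * q * exp (- ((2 * pi * snd \<xi> * snd x) *\<^sub>R qj))"

lemma norm_qft_kernel [simp]: "norm (qft_kernel \<xi> x q) = norm q"
  by (simp add: qft_kernel_def norm_mult)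

lemma borel_measurable_qft_kernel [measurable]:
  assumes [measurable]: "f \<in> borel_measurable borel"
  shows "(\<lambda>x. qft_kernel \<xi> x (f x)) \<in> borel_measurable borel"
proof -
  have [measurable]: "fst \<in> borel_measurable (borel :: (real \<times> real) measure)"
    "snd \<in> borel_measurable (borel :: (real \<times> real) measure)"
    by (intro borel_measurable_continuous_onI continuous_intros)+
  show ?thesis unfolding qft_kernel_def by measurable
qed

lemma qft_lborel:
  assumes "f \<in> borel_measurable borel"
  shows "qft f \<xi> = (\<integral>x. qft_kernel \<xi> x (f x) \<partial>lborel)"
  using integral_completion[of "\<lambda>x. qft_kernel \<xi> x (f x)" lborel] borel_measurable_qft_kernel[OF assms]
  by (simp add: qft_def qft_kernel_def)

lemma qft_cong_AE:
  assumes f: "f \<in> borel_measurable lebesgue" and g: "g \<in> borel_measurable borel"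
    and ae: "AE x in lebesgue. f x = g x"
  shows "qft f = qft g"
proof
  fix \<xi>
  have g': "g \<in> borel_measurable lebesgue" using g by (intro measurable_completion) simp
  have [measurable]: "fst \<in> borel_measurable (lebesgue :: (real \<times> real) measure)"
    "snd \<in> borel_measurable (lebesgue :: (real \<times> real) measure)"
    by (intro measurable_completion; simp, intro borel_measurable_continuous_onI continuous_intros)+
  show "qft f \<xi> = qft g \<xi>"
    unfolding qft_def
  proof (rule integral_cong_AE)
    show "AE x in lebesgue. exp (- ((2 * pi * fst \<xi> * fst x) *\<^sub>R qi)) * f x * exp (- ((2 * pi * snd \<xi> * snd x) *\<^sub>R qj))
       = exp (- ((2 * pi * fst \<xi> * fst x) *\<^sub>R qi)) * g x * exp (- ((2 * pi * snd \<xi> * snd x) *\<^sub>R qj))"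
      using ae by eventually_elim simp
  qed (use f g' in measurable)
qed

lemma integrable_qft_kernel:
  assumes f: "integrable lborel f"
  shows "integrable lborel (\<lambda>x. qft_kernel \<xi> x (f x))"
proof (rule Bochner_Integration.integrable_bound[OF f])
  show "(\<lambda>x. qft_kernel \<xi> x (f x)) \<in> borel_measurable lborel"
    using borel_measurable_qft_kernel[of f \<xi>] borel_measurable_integrable[OF f] by simp
qed simp

lemma continuous_on_qft:
  assumes f: "integrable lborel f"
  shows "continuous_on UNIV (qft f)"
proof (rule continuous_on_sequentiallyI)
  have fb: "f \<in> borel_measurable borel" using borel_measurable_integrable[OF f] by simp
  fix \<xi>s :: "nat \<Rightarrow> real \<times> real" and \<xi>
  assume lim: "\<xi>s \<longlonglongrightarrow> \<xi>"
  show "(\<lambda>n. qft f (\<xi>s n)) \<longlonglongrightarrow> qft f \<xi>"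
    unfolding qft_lborel[OF fb]
  proof (rule integral_dominated_convergence[where w = "\<lambda>x. norm (f x)"])
    show "AE x in lborel. (\<lambda>n. qft_kernel (\<xi>s n) x (f x)) \<longlonglongrightarrow> qft_kernel \<xi> x (f x)"
      unfolding qft_kernel_def using lim by (intro AE_I2 tendsto_intros)
    show "AE x in lborel. norm (qft_kernel (\<xi>s n) x (f x)) \<le> norm (f x)" for n
      by simp
  qed (use f fb borel_measurable_qft_kernel[OF fb] in simp_all)
qed

text \<open>The complement is open and null, hence empty. This promotes almost everywhere identities
  between continuous functions to identities at every point.\<close>

lemma closed_full_measure_UNIV:
  fixes S :: "'a::euclidean_space set"
  assumes "closed S" and ae: "AE x in lborel. x \<in> S"
  shows "S = UNIV"
proof -
  have "open (- S)" using assms(1) by (rule open_Compl)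
  moreover have "- S \<in> null_sets lborel"
    using assms by (subst AE_iff_null_sets) auto
  then have "negligible (- S)"
    by (intro negligible_iff_null_sets[THEN iffD2] null_sets_completionI)
  ultimately show ?thesis using open_not_negligible by blast
qed

section \<open>Complex coordinates and the partial transforms\<close>

text \<open>The coordinates \<open>u\<close>, \<open>v\<close> in \<open>q = u + v * qj\<close>,
  with \<open>u\<close> and \<open>v\<close> in the span of \<open>1\<close> and \<open>qi\<close>;
  a factor from that span on the left multiplies both.\<close>

lemma left_component:
  assumes "p \<in> {\<lambda>q. Complex (re_part q) (i_part q), \<lambda>q. Complex (j_part q) (k_part q)}"
  shows "bounded_linear p" "norm (p q) \<le> norm q" "p (exp (- (t *\<^sub>R qi)) * q) = cis (- t) * p q"
proof -
  show "bounded_linear p"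
    using assms by (intro linear_conv_bounded_linear[THEN iffD1] linearI)
      (auto simp: plus_quat_def scaleR_quat_def complex_eq_iff)
  show "norm (p q) \<le> norm q"
    using assms by (auto simp: cmod_def norm_quat_def)
  show "p (exp (- (t *\<^sub>R qi)) * q) = cis (- t) * p q"
    using assms by (auto simp: exp_qi times_quat_def complex_eq_iff)
qed

text \<open>The mirror image \<open>q = u + qi * v\<close>, with \<open>u\<close> and
  \<open>v\<close> in the span of \<open>1\<close> and \<open>qj\<close>. Since
  \<open>qi * qj = qk\<close>, the parts are paired differently, and now factors on the right act as
  scalars.\<close>

lemma right_component:
  assumes "p \<in> {\<lambda>q. Complex (re_part q) (j_part q), \<lambda>q. Complex (i_part q) (k_part q)}"
  shows "bounded_linear p" "norm (p q) \<le> norm q" "p (q * exp (- (t *\<^sub>R qj))) = cis (- t) * p q"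
proof -
  show "bounded_linear p"
    using assms by (intro linear_conv_bounded_linear[THEN iffD1] linearI)
      (auto simp: plus_quat_def scaleR_quat_def complex_eq_iff)
  show "norm (p q) \<le> norm q"
    using assms by (auto simp: cmod_def norm_quat_def)
  show "p (q * exp (- (t *\<^sub>R qj))) = cis (- t) * p q"
    using assms by (auto simp: exp_qj times_quat_def complex_eq_iff)
qed

lemma gauss_dominated_norm_cong:
  assumes "gauss_dominated a f" "g \<in> borel_measurable borel" "\<And>x. norm (g x) = norm (f x)"
  shows "gauss_dominated a g"
  using assms unfolding gauss_dominated_def by simp

text \<open>
  For fixed second frequency, left multiplication by \<open>exp (- t i)\<close> is complex scalar multiplication on
  the two \<open>C(i)\<close>-components of a quaternion, so each component is an ordinary complex Fourier integral;
  for fixed first frequency the same holds on the right with \<open>j\<close>.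
\<close>

lemma qft_partial_gaussian:
  assumes a: "a > 0" and dom: "gauss_dominated a f"
    and fin: "(\<integral>\<^sup>+\<xi>. ennreal (log_plus (norm (exp (pi\<^sup>2 / a * (norm \<xi>)\<^sup>2) *\<^sub>R qft f \<xi>) / \<rho>)) \<partial>lborel) < \<infinity>"
    and \<rho>: "\<rho> > 0"
  shows "exp (pi\<^sup>2 / a * s\<^sup>2) *\<^sub>R qft f (s, y) = qft f (0, y)"
    and "exp (pi\<^sup>2 / a * s\<^sup>2) *\<^sub>R qft f (y, s) = qft f (y, 0)"
proof -
  define b where "b = pi\<^sup>2 / a"
  have int: "integrable lborel f" using gauss_dominated_integrable[OF dom a] .
  have fb [measurable]: "f \<in> borel_measurable borel" using dom by (simp add: gauss_dominated_def)
  have cont: "continuous_on UNIV (qft f)" using int by (rule continuous_on_qft)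
  have [measurable]: "fst \<in> borel_measurable (borel :: (real \<times> real) measure)"
    "snd \<in> borel_measurable (borel :: (real \<times> real) measure)"
    by (intro borel_measurable_continuous_onI continuous_intros)+
  define L where "L \<xi> = ennreal (log_plus (norm (exp (b * (norm \<xi>)\<^sup>2) *\<^sub>R qft f \<xi>) / \<rho>))" for \<xi>
  have "(\<lambda>\<xi>. norm (exp (b * (norm \<xi>)\<^sup>2) *\<^sub>R qft f \<xi>) / \<rho>) \<in> borel_measurable borel"
    using \<rho> by (intro borel_measurable_continuous_onI continuous_intros cont) simp
  then have L [measurable]: "L \<in> borel_measurable borel" unfolding L_def by measurable
  have L' [measurable]: "L \<in> borel_measurable (borel \<Otimes>\<^sub>M borel)"
    using L by (simp add: borel_prod)
  have finL: "(\<integral>\<^sup>+\<xi>. L \<xi> \<partial>lborel) < \<infinity>" using fin by (simp add: L_def b_def)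
  have component: "of_real (exp (b * s\<^sup>2)) * T (Qs s) = T (Qs 0)"
    if T: "bounded_linear T" "\<And>q. norm (T q) \<le> norm q" and e: "norm e = 1"
      and dH: "gauss_dominated a H"
      and Qs: "\<And>s. T (Qs s) = (\<integral>x. cis (- (2 * pi * s * (x \<bullet> e))) * T (H x) \<partial>lborel)"
      and eq: "\<And>s. L (\<iota> s) = ennreal (log_plus (exp (b * (s\<^sup>2 + y\<^sup>2)) * norm (Qs s) / \<rho>))"
      and fin: "(\<integral>\<^sup>+s. L (\<iota> s) \<partial>lborel) \<noteq> \<infinity>"
    for T and e and Qs :: "real \<Rightarrow> quat" and H :: "real \<times> real \<Rightarrow> quat" and \<iota> y s
    unfolding b_def
  proof (rule fourier_component_gaussian[OF a dH e T Qs])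
    \<comment> \<open>With the other frequency frozen at \<open>y\<close>, the factor
      \<open>exp (b y^2)\<close> of the weight is a constant and moves into the threshold.\<close>
    show "\<rho> * exp (- b * y\<^sup>2) > 0" using \<rho> by simp
    have "(\<integral>\<^sup>+\<xi>. ennreal (log_plus (exp (pi\<^sup>2 / a * \<xi>\<^sup>2) * norm (T (Qs \<xi>)) / (\<rho> * exp (- b * y\<^sup>2)))) \<partial>lborel)
      \<le> (\<integral>\<^sup>+s. L (\<iota> s) \<partial>lborel)"
      unfolding eq
    proof (intro nn_integral_mono ennreal_leI log_plus_mono)
      fix s
      have "exp (pi\<^sup>2 / a * s\<^sup>2) * norm (T (Qs s)) / (\<rho> * exp (- b * y\<^sup>2)) = exp (b * (s\<^sup>2 + y\<^sup>2)) * norm (T (Qs s)) / \<rho>"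
        by (simp add: b_def distrib_left exp_add exp_minus field_simps)
      also have "\<dots> \<le> exp (b * (s\<^sup>2 + y\<^sup>2)) * norm (Qs s) / \<rho>"
        using \<rho> T(2) by (intro divide_right_mono mult_left_mono) auto
      finally show "exp (pi\<^sup>2 / a * s\<^sup>2) * norm (T (Qs s)) / (\<rho> * exp (- b * y\<^sup>2)) \<le> exp (b * (s\<^sup>2 + y\<^sup>2)) * norm (Qs s) / \<rho>" .
    qed
    also have "\<dots> < \<infinity>" using fin by (simp add: less_top)
    finally show "(\<integral>\<^sup>+\<xi>. ennreal (log_plus (exp (pi\<^sup>2 / a * \<xi>\<^sup>2) * norm (T (Qs \<xi>)) / (\<rho> * exp (- b * y\<^sup>2)))) \<partial>lborel) < \<infinity>" .
  qed
  have left: "exp (b * s\<^sup>2) *\<^sub>R qft f (s, y) = qft f (0, y)" if finite: "(\<integral>\<^sup>+s. L (s, y) \<partial>lborel) \<noteq> \<infinity>" for s y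
  proof -
    let ?H = "\<lambda>x. f x * exp (- ((2 * pi * y * snd x) *\<^sub>R qj))"
    have "exp (b * s\<^sup>2) *\<^sub>R p (qft f (s, y)) = p (qft f (0, y))"
      if p: "p \<in> {\<lambda>q. Complex (re_part q) (i_part q), \<lambda>q. Complex (j_part q) (k_part q)}" for p
      unfolding scaleR_conv_of_real
    proof (rule component[where \<iota> = "\<lambda>s. (s, y)" and H = ?H and e = "(1, 0)" and Qs = "\<lambda>s. qft f (s, y)"])
      show "gauss_dominated a ?H"
        by (rule gauss_dominated_norm_cong[OF dom]) (simp_all add: norm_mult)
      show "p (qft f (s, y)) = (\<integral>x. cis (- (2 * pi * s * (x \<bullet> (1, 0)))) * p (?H x) \<partial>lborel)" for s
        unfolding qft_lborel[OF fb]
        by (subst integral_bounded_linear[OF left_component(1)[OF p] integrable_qft_kernel[OF int], symmetric])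
          (simp add: qft_kernel_def mult.assoc left_component(3)[OF p] inner_prod_def)
      show "L (s, y) = ennreal (log_plus (exp (b * (s\<^sup>2 + y\<^sup>2)) * norm (qft f (s, y)) / \<rho>))" for s
        by (simp add: L_def norm_prod_power2)
    qed (use left_component[OF p] finite in \<open>simp_all add: norm_prod_def\<close>)
    from this[of "\<lambda>q. Complex (re_part q) (i_part q)"] this[of "\<lambda>q. Complex (j_part q) (k_part q)"]
    show ?thesis by (simp add: quat_eq_iff scaleR_quat_def complex_eq_iff)
  qed
  have right: "exp (b * s\<^sup>2) *\<^sub>R qft f (y, s) = qft f (y, 0)" if finite: "(\<integral>\<^sup>+s. L (y, s) \<partial>lborel) \<noteq> \<infinity>" for s y
  proof -
    let ?H = "\<lambda>x. exp (- ((2 * pi * y * fst x) *\<^sub>R qi)) * f x"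
    have "exp (b * s\<^sup>2) *\<^sub>R p (qft f (y, s)) = p (qft f (y, 0))"
      if p: "p \<in> {\<lambda>q. Complex (re_part q) (j_part q), \<lambda>q. Complex (i_part q) (k_part q)}" for p
      unfolding scaleR_conv_of_real
    proof (rule component[where \<iota> = "\<lambda>s. (y, s)" and H = ?H and e = "(0, 1)" and Qs = "\<lambda>s. qft f (y, s)"])
      show "gauss_dominated a ?H"
        by (rule gauss_dominated_norm_cong[OF dom]) (simp_all add: norm_mult)
      show "p (qft f (y, s)) = (\<integral>x. cis (- (2 * pi * s * (x \<bullet> (0, 1)))) * p (?H x) \<partial>lborel)" for s
        unfolding qft_lborel[OF fb]
        by (subst integral_bounded_linear[OF right_component(1)[OF p] integrable_qft_kernel[OF int], symmetric])
          (simp add: qft_kernel_def right_component(3)[OF p] inner_prod_def)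
      show "L (y, s) = ennreal (log_plus (exp (b * (s\<^sup>2 + y\<^sup>2)) * norm (qft f (y, s)) / \<rho>))" for s
        by (simp add: L_def norm_prod_power2 add.commute)
    qed (use right_component[OF p] finite in \<open>simp_all add: norm_prod_def\<close>)
    from this[of "\<lambda>q. Complex (re_part q) (j_part q)"] this[of "\<lambda>q. Complex (i_part q) (k_part q)"]
    show ?thesis by (simp add: quat_eq_iff scaleR_quat_def complex_eq_iff)
  qed
  have c1: "continuous_on UNIV (\<lambda>y. qft f (s, y))" and c2: "continuous_on UNIV (\<lambda>y. qft f (y, s))" for s
    by (intro continuous_on_compose2[OF cont] continuous_intros; simp)+
  \<comment> \<open>Fubini gives a finite slice only for almost every \<open>y\<close>; continuity
    of the transform supplies the rest. The exceptional slices matter, since the two identities will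
    be combined on a coordinate axis.\<close>
  have "AE y in lborel. (\<integral>\<^sup>+s. L (s, y) \<partial>lborel) \<noteq> \<infinity>"
    using finL nn_integral_lborel_pair(2)[OF L] by (intro nn_integral_PInf_AE) auto
  then have "AE y in lborel. y \<in> {y. exp (b * s\<^sup>2) *\<^sub>R qft f (s, y) = qft f (0, y)}"
    by eventually_elim (simp add: left)
  moreover have "closed {y. exp (b * s\<^sup>2) *\<^sub>R qft f (s, y) = qft f (0, y)}"
    by (intro closed_Collect_eq continuous_intros c1)
  ultimately have "{y. exp (b * s\<^sup>2) *\<^sub>R qft f (s, y) = qft f (0, y)} = UNIV"
    by (intro closed_full_measure_UNIV)
  then show "exp (pi\<^sup>2 / a * s\<^sup>2) *\<^sub>R qft f (s, y) = qft f (0, y)" unfolding b_def by blast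
  have "AE y in lborel. (\<integral>\<^sup>+s. L (y, s) \<partial>lborel) \<noteq> \<infinity>"
    using finL nn_integral_lborel_pair(1)[OF L] by (intro nn_integral_PInf_AE) auto
  then have "AE y in lborel. y \<in> {y. exp (b * s\<^sup>2) *\<^sub>R qft f (y, s) = qft f (y, 0)}"
    by eventually_elim (simp add: right)
  moreover have "closed {y. exp (b * s\<^sup>2) *\<^sub>R qft f (y, s) = qft f (y, 0)}"
    by (intro closed_Collect_eq continuous_intros c2)
  ultimately have "{y. exp (b * s\<^sup>2) *\<^sub>R qft f (y, s) = qft f (y, 0)} = UNIV"
    by (intro closed_full_measure_UNIV)
  then show "exp (pi\<^sup>2 / a * s\<^sup>2) *\<^sub>R qft f (y, s) = qft f (y, 0)" unfolding b_def by blast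
qed

text \<open>The first partial identity leads from \<open>(s, t)\<close> to \<open>(0, t)\<close>,
  and the second, on the axis \<open>y = 0\<close>, from there to the origin. The two exponents add
  up to the squared norm.\<close>

lemma qft_eq_gaussian:
  assumes "a > 0" "gauss_dominated a f" "condition_B (pi\<^sup>2 / a) f"
  shows "qft f \<xi> = exp (- (pi\<^sup>2 / a * (norm \<xi>)\<^sup>2)) *\<^sub>R qft f 0"
proof -
  obtain \<rho> where \<rho>: "\<rho> > 0"
    and fin: "(\<integral>\<^sup>+\<xi>. ennreal (log_plus (norm (exp (pi\<^sup>2 / a * (norm \<xi>)\<^sup>2) *\<^sub>R qft f \<xi>) / \<rho>)) \<partial>lebesgue) < \<infinity>"
    using assms(3) unfolding condition_B_def by blast
  have fin': "(\<integral>\<^sup>+\<xi>. ennreal (log_plus (norm (exp (pi\<^sup>2 / a * (norm \<xi>)\<^sup>2) *\<^sub>R qft f \<xi>) / \<rho>)) \<partial>lborel) < \<infinity>"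
    using fin by (simp only: nn_integral_completion)
  note partial = qft_partial_gaussian[OF assms(1,2) fin' \<rho>]
  obtain s t where \<xi>: "\<xi> = (s, t)" by (cases \<xi>)
  have "exp (pi\<^sup>2 / a * (norm \<xi>)\<^sup>2) *\<^sub>R qft f \<xi> = exp (pi\<^sup>2 / a * t\<^sup>2) *\<^sub>R (exp (pi\<^sup>2 / a * s\<^sup>2) *\<^sub>R qft f (s, t))"
    unfolding \<xi> norm_prod_power2 by (simp add: distrib_left exp_add mult.commute)
  also have "\<dots> = qft f (0, 0)" by (simp only: partial)
  finally have "exp (- (pi\<^sup>2 / a * (norm \<xi>)\<^sup>2)) *\<^sub>R (exp (pi\<^sup>2 / a * (norm \<xi>)\<^sup>2) *\<^sub>R qft f \<xi>)
      = exp (- (pi\<^sup>2 / a * (norm \<xi>)\<^sup>2)) *\<^sub>R qft f 0"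
    by (simp only: zero_prod_def)
  then show ?thesis by (simp add: mult_exp_exp)
qed

section \<open>Injectivity of the transform\<close>

text \<open>Reduction to uniqueness of characteristic functions. The positive and negative parts
  have equal mass \<open>m\<close> by the case \<open>t = 0\<close>. If \<open>m\<close> is
  positive, dividing by it gives two probability densities with the same characteristic function; if
  \<open>m = 0\<close>, both parts vanish almost everywhere.\<close>

lemma AE_zero_if_fourier_zero_real:
  fixes \<phi> :: "real \<Rightarrow> real"
  assumes int: "integrable lborel \<phi>"
    and cos: "\<And>t. (\<integral>x. cos (t * x) * \<phi> x \<partial>lborel) = 0"
    and sin: "\<And>t. (\<integral>x. sin (t * x) * \<phi> x \<partial>lborel) = 0"
  shows "AE x in lborel. \<phi> x = 0"
proof -
  have [measurable]: "\<phi> \<in> borel_measurable borel" using borel_measurable_integrable[OF int] by simp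
  define p where "p x = max 0 (\<phi> x)" for x
  define n where "n x = max 0 (- \<phi> x)" for x
  have pn: "integrable lborel p" "integrable lborel n" "\<And>x. 0 \<le> p x" "\<And>x. 0 \<le> n x" "\<And>x. \<phi> x = p x - n x"
    unfolding p_def[abs_def] n_def[abs_def] using int
    by (auto intro!: integrable_max Bochner_Integration.integrable_minus)
  have [measurable]: "p \<in> borel_measurable borel" "n \<in> borel_measurable borel"
    unfolding p_def[abs_def] n_def[abs_def] by measurable
  define m where "m = (\<integral>x. p x \<partial>lborel)"
  have mn: "(\<integral>x. n x \<partial>lborel) = m"
    using cos[of 0] by (simp add: m_def pn(5) Bochner_Integration.integral_diff[OF pn(1,2)])
  have m0: "0 \<le> m" unfolding m_def by (rule Bochner_Integration.integral_nonneg[OF pn(3)])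
  show ?thesis
  proof (cases "m = 0")
    case True
    then have "(\<integral>x. p x \<partial>lborel) = 0" "(\<integral>x. n x \<partial>lborel) = 0"
      using mn by (simp_all add: m_def)
    then have "AE x in lborel. p x = 0" "AE x in lborel. n x = 0"
      by (simp_all only: integral_nonneg_eq_0_iff_AE[OF pn(1) AE_I2[OF pn(3)]]
          integral_nonneg_eq_0_iff_AE[OF pn(2) AE_I2[OF pn(4)]])
    then show ?thesis by eventually_elim (simp add: pn(5))
  next
    case False
    then have m: "m > 0" using m0 by simp
    have dist: "real_distribution (density lborel (\<lambda>x. ennreal (r x / m)))"
      if r: "integrable lborel r" "\<And>x. 0 \<le> r x" "(\<integral>x. r x \<partial>lborel) = m" for r
    proof -
      have [measurable]: "r \<in> borel_measurable borel" using borel_measurable_integrable[OF r(1)] by simp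
      have "emeasure (density lborel (\<lambda>x. ennreal (r x / m))) UNIV = (\<integral>\<^sup>+x. ennreal (r x / m) \<partial>lborel)"
        by (simp add: emeasure_density)
      also have "\<dots> = ennreal (\<integral>x. r x / m \<partial>lborel)"
        using r m by (intro nn_integral_eq_integral) auto
      also have "(\<integral>x. r x / m \<partial>lborel) = 1" using r m by simp
      finally have "prob_space (density lborel (\<lambda>x. ennreal (r x / m)))"
        by (intro prob_spaceI) simp
      then show ?thesis
        by (simp add: real_distribution_def real_distribution_axioms_def)
    qed
    have char_density: "char (density lborel (\<lambda>x. ennreal (r x / m))) t
        = (of_real (\<integral>x. cos (t * x) * r x \<partial>lborel) + \<i> * of_real (\<integral>x. sin (t * x) * r x \<partial>lborel)) / of_real m"
      if r: "integrable lborel r" "\<And>x. 0 \<le> r x" for r t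
    proof -
      have [measurable]: "r \<in> borel_measurable borel" using borel_measurable_integrable[OF r(1)] by simp
      have ci: "integrable lborel (\<lambda>x. cos (t * x) * r x)" "integrable lborel (\<lambda>x. sin (t * x) * r x)"
        by (rule Bochner_Integration.integrable_bound[OF r(1)]; simp add: abs_mult mult_left_le_one_le)+
      have "char (density lborel (\<lambda>x. ennreal (r x / m))) t = (\<integral>x. (r x / m) *\<^sub>R cis (t * x) \<partial>lborel)"
        unfolding char_def using r m by (subst integral_density) (auto simp: cis_conv_exp)
      also have "\<dots> = (\<integral>x. (of_real (cos (t * x) * r x) + \<i> * of_real (sin (t * x) * r x)) / of_real m \<partial>lborel)"
        by (intro Bochner_Integration.integral_cong) (auto simp: complex_eq_iff mult.commute)
      also have "\<dots> = (\<integral>x. of_real (cos (t * x) * r x) + \<i> * of_real (sin (t * x) * r x) \<partial>lborel) / of_real m"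
        by (rule integral_divide_zero)
      also have "(\<integral>x. of_real (cos (t * x) * r x) + \<i> * of_real (sin (t * x) * r x) \<partial>lborel)
        = (\<integral>x. of_real (cos (t * x) * r x) \<partial>lborel) + (\<integral>x. \<i> * of_real (sin (t * x) * r x) \<partial>lborel)"
        using ci by (intro Bochner_Integration.integral_add integrable_mult_right integrable_of_real)
      also have "\<dots> = of_real (\<integral>x. cos (t * x) * r x \<partial>lborel) + \<i> * of_real (\<integral>x. sin (t * x) * r x \<partial>lborel)"
        by (simp only: integral_mult_right_zero integral_complex_of_real)
      finally show ?thesis .
    qed
    have "(\<integral>x. cos (t * x) * p x \<partial>lborel) = (\<integral>x. cos (t * x) * n x \<partial>lborel)"
      "(\<integral>x. sin (t * x) * p x \<partial>lborel) = (\<integral>x. sin (t * x) * n x \<partial>lborel)" for t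
    proof -
      have ci: "integrable lborel (\<lambda>x. cos (t * x) * r x)" "integrable lborel (\<lambda>x. sin (t * x) * r x)"
        if "integrable lborel r" for r
        by (rule Bochner_Integration.integrable_bound[OF that];
            use borel_measurable_integrable[OF that] in \<open>simp add: abs_mult mult_left_le_one_le\<close>)+
      show "(\<integral>x. cos (t * x) * p x \<partial>lborel) = (\<integral>x. cos (t * x) * n x \<partial>lborel)"
        "(\<integral>x. sin (t * x) * p x \<partial>lborel) = (\<integral>x. sin (t * x) * n x \<partial>lborel)"
        using cos[of t] sin[of t] by (simp_all add: pn(5) right_diff_distrib ci pn(1,2))
    qed
    then have "char (density lborel (\<lambda>x. ennreal (p x / m))) = char (density lborel (\<lambda>x. ennreal (n x / m)))"
      by (intro ext) (simp add: char_density pn(1-4))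
    then have "density lborel (\<lambda>x. ennreal (p x / m)) = density lborel (\<lambda>x. ennreal (n x / m))"
      by (intro Levy_uniqueness dist pn(1-4) mn m_def[symmetric])
    then have "AE x in lborel. ennreal (p x / m) = ennreal (n x / m)"
      by (subst (asm) sigma_finite_measure.density_unique_iff[OF sigma_finite_lborel]) auto
    then show ?thesis
    proof eventually_elim
      case (elim x)
      then have "p x / m = n x / m" using pn(3,4) m by (simp add: ennreal_inj)
      then show ?case using m by (simp add: pn(5))
    qed
  qed
qed

lemma AE_zero_if_fourier_zero:
  fixes \<phi> :: "real \<Rightarrow> 'b::euclidean_space"
  assumes int: "integrable lborel \<phi>"
    and cos: "\<And>t. (\<integral>x. cos (t * x) *\<^sub>R \<phi> x \<partial>lborel) = 0"
    and sin: "\<And>t. (\<integral>x. sin (t * x) *\<^sub>R \<phi> x \<partial>lborel) = 0"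
  shows "AE x in lborel. \<phi> x = 0"
proof -
  have ci: "integrable lborel (\<lambda>x. cos (t * x) *\<^sub>R \<phi> x)" "integrable lborel (\<lambda>x. sin (t * x) *\<^sub>R \<phi> x)" for t
    by (rule Bochner_Integration.integrable_bound[OF int];
        use borel_measurable_integrable[OF int] in \<open>simp add: mult_left_le_one_le\<close>)+
  have "AE x in lborel. \<phi> x \<bullet> b = 0" for b
  proof (rule AE_zero_if_fourier_zero_real)
    show "integrable lborel (\<lambda>x. \<phi> x \<bullet> b)" using int by simp
    show "(\<integral>x. cos (t * x) * (\<phi> x \<bullet> b) \<partial>lborel) = 0" for t
      using integral_inner_left[of b lborel "\<lambda>x. cos (t * x) *\<^sub>R \<phi> x"] ci cos by simp
    show "(\<integral>x. sin (t * x) * (\<phi> x \<bullet> b) \<partial>lborel) = 0" for t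
      using integral_inner_left[of b lborel "\<lambda>x. sin (t * x) *\<^sub>R \<phi> x"] ci sin by simp
  qed
  then have "AE x in lborel. \<forall>b\<in>Basis. \<phi> x \<bullet> b = 0"
    by (intro AE_finite_allI finite_Basis)
  then show ?thesis
    by eventually_elim (simp add: euclidean_all_zero_iff)
qed

text \<open>\<open>L\<close> covers both left multiplication by \<open>qi\<close> and right
  multiplication by \<open>qj\<close>. The cosine integral \<open>A\<close> is even in
  \<open>t\<close> and the sine integral \<open>B\<close> odd, so comparing \<open>t\<close> with
  \<open>- t\<close> gives \<open>A = 0\<close> and \<open>L (B t) = 0\<close>, and the kernel of
  \<open>L\<close> is trivial.\<close>

lemma quat_cos_sin_integrals_zero:
  fixes \<phi> :: "real \<Rightarrow> quat" and L :: "quat \<Rightarrow> quat"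
  assumes int: "integrable lborel \<phi>"
    and L: "bounded_linear L" "\<And>q. L q = 0 \<Longrightarrow> q = 0"
    and zero: "\<And>t. (\<integral>x. cos (2 * pi * t * x) *\<^sub>R \<phi> x - sin (2 * pi * t * x) *\<^sub>R L (\<phi> x) \<partial>lborel) = 0"
  shows "AE x in lborel. \<phi> x = 0"
proof -
  have ci: "integrable lborel (\<lambda>x. cos (t * x) *\<^sub>R \<phi> x)" "integrable lborel (\<lambda>x. sin (t * x) *\<^sub>R \<phi> x)" for t
    by (rule Bochner_Integration.integrable_bound[OF int];
        use borel_measurable_integrable[OF int] in \<open>simp add: mult_left_le_one_le\<close>)+
  have L_scale: "L (c *\<^sub>R q) = c *\<^sub>R L q" for c q
    by (rule linear_scale[OF bounded_linear.linear[OF L(1)]])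
  have L_minus: "L (- q) = - L q" for q
    using L_scale[of "-1" q] by simp
  define A where "A t = (\<integral>x. cos (t * x) *\<^sub>R \<phi> x \<partial>lborel)" for t
  define B where "B t = (\<integral>x. sin (t * x) *\<^sub>R \<phi> x \<partial>lborel)" for t
  have split: "A t - L (B t) = 0" for t
  proof -
    have "L (B t) = (\<integral>x. sin (t * x) *\<^sub>R L (\<phi> x) \<partial>lborel)"
      unfolding B_def integral_bounded_linear[OF L(1) ci(2), symmetric] L_scale ..
    moreover have "integrable lborel (\<lambda>x. sin (t * x) *\<^sub>R L (\<phi> x))"
      using integrable_bounded_linear[OF L(1) ci(2)[of t]] unfolding L_scale .
    moreover have "(\<integral>x. cos (t * x) *\<^sub>R \<phi> x - sin (t * x) *\<^sub>R L (\<phi> x) \<partial>lborel) = 0"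
      using zero[of "t / (2 * pi)"] by simp
    ultimately show ?thesis
      unfolding A_def by (simp only: Bochner_Integration.integral_diff[OF ci(1)])
  qed
  have "A (- t) = A t" "B (- t) = - B t" for t
    by (simp_all add: A_def B_def)
  then have neg: "A t + L (B t) = 0" for t
    using split[of "- t"] by (simp add: L_minus)
  have c0: "A t = 0" for t
  proof -
    have "A t + A t = (A t - L (B t)) + (A t + L (B t))"
      by (simp only: diff_conv_add_uminus add_ac) simp
    then have "2 *\<^sub>R A t = 0"
      by (simp only: scaleR_2 split neg add_0)
    then show ?thesis by simp
  qed
  have "B t = 0" for t
    by (rule L(2)) (use neg[of t] c0[of t] in simp)
  with c0 show ?thesis unfolding A_def B_def by (intro AE_zero_if_fourier_zero[OF int])
qed

lemma AE_zero_if_left_fourier_zero: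
  assumes int: "integrable lborel \<phi>"
    and zero: "\<And>t. (\<integral>x. exp (- ((2 * pi * t * x) *\<^sub>R qi)) * \<phi> x \<partial>lborel) = 0"
  shows "AE x in lborel. \<phi> x = 0"
proof (rule quat_cos_sin_integrals_zero[OF int])
  show "bounded_linear ((*) qi)" by (rule bounded_linear_mult_right)
  have "qi \<noteq> 0" by (simp add: qi_def zero_quat_def)
  then show "qi * q = 0 \<Longrightarrow> q = 0" for q by simp
  show "(\<integral>x. cos (2 * pi * t * x) *\<^sub>R \<phi> x - sin (2 * pi * t * x) *\<^sub>R (qi * \<phi> x) \<partial>lborel) = 0" for t
    using zero[of t] by (simp add: exp_qi_scaleR left_diff_distrib)
qed

lemma AE_zero_if_right_fourier_zero:
  assumes int: "integrable lborel \<phi>"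
    and zero: "\<And>t. (\<integral>x. \<phi> x * exp (- ((2 * pi * t * x) *\<^sub>R qj)) \<partial>lborel) = 0"
  shows "AE x in lborel. \<phi> x = 0"
proof (rule quat_cos_sin_integrals_zero[OF int])
  show "bounded_linear (\<lambda>q. q * qj)" by (rule bounded_linear_mult_left)
  have "qj \<noteq> 0" by (simp add: qj_def zero_quat_def)
  then show "q * qj = 0 \<Longrightarrow> q = 0" for q by simp
  show "(\<integral>x. cos (2 * pi * t * x) *\<^sub>R \<phi> x - sin (2 * pi * t * x) *\<^sub>R (\<phi> x * qj) \<partial>lborel) = 0" for t
    using zero[of t] by (simp add: exp_qj_scaleR right_diff_distrib)
qed

lemma continuous_on_right_fourier:
  fixes \<phi> :: "real \<Rightarrow> quat"
  assumes int: "integrable lborel \<phi>"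
  shows "continuous_on UNIV (\<lambda>t. \<integral>x. \<phi> x * exp (- ((2 * pi * t * x) *\<^sub>R qj)) \<partial>lborel)"
proof (rule continuous_on_sequentiallyI)
  have [measurable]: "\<phi> \<in> borel_measurable borel" using borel_measurable_integrable[OF int] by simp
  fix ts :: "nat \<Rightarrow> real" and t assume lim: "ts \<longlonglongrightarrow> t"
  show "(\<lambda>n. \<integral>x. \<phi> x * exp (- ((2 * pi * ts n * x) *\<^sub>R qj)) \<partial>lborel)
      \<longlonglongrightarrow> (\<integral>x. \<phi> x * exp (- ((2 * pi * t * x) *\<^sub>R qj)) \<partial>lborel)"
  proof (rule integral_dominated_convergence[where w = "\<lambda>x. norm (\<phi> x)"])
    show "AE x in lborel. (\<lambda>n. \<phi> x * exp (- ((2 * pi * ts n * x) *\<^sub>R qj))) \<longlonglongrightarrow> \<phi> x * exp (- ((2 * pi * t * x) *\<^sub>R qj))"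
      using lim by (intro AE_I2 tendsto_intros)
    show "AE x in lborel. norm (\<phi> x * exp (- ((2 * pi * ts n * x) *\<^sub>R qj))) \<le> norm (\<phi> x)" for n
      by (simp add: norm_mult)
  qed (use int in simp_all)
qed

text \<open>For fixed second frequency \<open>y\<close> the transform is a one-variable left
  transform of \<open>\<Phi> y\<close>, which is itself a right transform along each vertical line.
  Undoing the left one and then the right one leaves \<open>f\<close>.\<close>

lemma AE_zero_if_qft_zero:
  assumes int: "integrable lborel f" and zero: "\<And>\<xi>. qft f \<xi> = 0"
  shows "AE x in lborel. f x = 0"
proof -
  have fb [measurable]: "f \<in> borel_measurable borel" using borel_measurable_integrable[OF int] by simp
  have [measurable]: "f \<in> borel_measurable (borel \<Otimes>\<^sub>M borel)" using fb by (simp add: borel_prod)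
  define \<Phi> where "\<Phi> y s = (\<integral>t. f (s, t) * exp (- ((2 * pi * y * t) *\<^sub>R qj)) \<partial>lborel)" for y s
  have "AE s in lborel. \<Phi> y s = 0" for y
  proof (rule AE_zero_if_left_fourier_zero)
    have iH: "integrable (lborel \<Otimes>\<^sub>M lborel) (\<lambda>x. f x * exp (- ((2 * pi * y * snd x) *\<^sub>R qj)))"
    proof (rule Bochner_Integration.integrable_bound)
      show "integrable (lborel \<Otimes>\<^sub>M lborel) f" using int by (simp add: lborel_prod)
    qed (simp_all add: norm_mult)
    from lborel_pair.integrable_fst'[OF iH] show "integrable lborel (\<Phi> y)"
      by (simp add: \<Phi>_def[abs_def])
    show "(\<integral>s. exp (- ((2 * pi * u * s) *\<^sub>R qi)) * \<Phi> y s \<partial>lborel) = 0" for u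
    proof -
      have ik: "integrable (lborel \<Otimes>\<^sub>M lborel) (\<lambda>x. qft_kernel (u, y) x (f x))"
        using integrable_qft_kernel[OF int] by (simp add: lborel_prod)
      have "0 = (\<integral>x. qft_kernel (u, y) x (f x) \<partial>(lborel \<Otimes>\<^sub>M lborel))"
        using zero[of "(u, y)"] by (simp add: qft_lborel[OF fb] lborel_prod)
      also have "\<dots> = (\<integral>s. \<integral>t. qft_kernel (u, y) (s, t) (f (s, t)) \<partial>lborel \<partial>lborel)"
        by (rule lborel_pair.integral_fst'[OF ik, symmetric])
      also have "\<dots> = (\<integral>s. exp (- ((2 * pi * u * s) *\<^sub>R qi)) * \<Phi> y s \<partial>lborel)"
      proof (rule integral_cong_AE)
        show "AE s in lborel. (\<integral>t. qft_kernel (u, y) (s, t) (f (s, t)) \<partial>lborel) = exp (- ((2 * pi * u * s) *\<^sub>R qi)) * \<Phi> y s"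
          using lborel_pair.AE_integrable_fst'[OF iH]
        proof eventually_elim
          case (elim s)
          have "qft_kernel (u, y) (s, t) (f (s, t))
            = exp (- ((2 * pi * u * s) *\<^sub>R qi)) * (f (s, t) * exp (- ((2 * pi * y * t) *\<^sub>R qj)))" for t
            by (simp only: qft_kernel_def fst_conv snd_conv mult.assoc)
          then have "(\<integral>t. qft_kernel (u, y) (s, t) (f (s, t)) \<partial>lborel)
            = (\<integral>t. exp (- ((2 * pi * u * s) *\<^sub>R qi)) * (f (s, t) * exp (- ((2 * pi * y * t) *\<^sub>R qj))) \<partial>lborel)"
            by (simp only:)
          also have "\<dots> = exp (- ((2 * pi * u * s) *\<^sub>R qi)) * (\<integral>t. f (s, t) * exp (- ((2 * pi * y * t) *\<^sub>R qj)) \<partial>lborel)"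
            by (rule Bochner_Integration.integral_mult_right) (use elim in \<open>simp only: snd_conv\<close>)
          finally show ?case by (simp only: \<Phi>_def)
        qed
        show "(\<lambda>s. \<integral>t. qft_kernel (u, y) (s, t) (f (s, t)) \<partial>lborel) \<in> borel_measurable lborel"
          using lborel_pair.integrable_fst'[OF ik] by (rule borel_measurable_integrable)
        show "(\<lambda>s. exp (- ((2 * pi * u * s) *\<^sub>R qi)) * \<Phi> y s) \<in> borel_measurable lborel"
          using \<open>integrable lborel (\<Phi> y)\<close>[THEN borel_measurable_integrable] by measurable
      qed
      finally show ?thesis by simp
    qed
  qed
  \<comment> \<open>The null set of \<open>s\<close> depends on \<open>y\<close>. Rational
    \<open>y\<close> give a common one, and continuity in \<open>y\<close> recovers the remaining
    frequencies.\<close>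
  then have "AE s in lborel. \<forall>r::rat. \<Phi> (of_rat r) s = 0"
    by (simp add: AE_all_countable)
  moreover have "AE s in lborel. integrable lborel (\<lambda>t. f (s, t))"
    using lborel_pair.AE_integrable_fst'[of f] int by (simp add: lborel_prod)
  ultimately have "AE s in lborel. AE t in lborel. f (s, t) = 0"
  proof eventually_elim
    case (elim s)
    show ?case
    proof (rule AE_zero_if_right_fourier_zero)
      fix y
      have "closed {y. \<Phi> y s = 0}"
        unfolding \<Phi>_def by (intro closed_Collect_eq continuous_on_right_fourier continuous_on_const elim)
      moreover have "\<rat> \<subseteq> {y. \<Phi> y s = 0}" using elim by (auto simp: Rats_def)
      ultimately have "closure \<rat> \<subseteq> {y. \<Phi> y s = 0}" by (rule closure_minimal[rotated])
      then show "(\<integral>t. f (s, t) * exp (- ((2 * pi * y * t) *\<^sub>R qj)) \<partial>lborel) = 0"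
        by (auto simp: Rats_closure_real \<Phi>_def)
    qed (use elim in simp)
  qed
  moreover have "{x \<in> space (lborel \<Otimes>\<^sub>M lborel). f x = 0} \<in> sets (lborel \<Otimes>\<^sub>M lborel)"
    by measurable
  ultimately have "AE x in lborel \<Otimes>\<^sub>M lborel. f x = 0"
    by (intro lborel_pair.AE_pair_measure)
  then show ?thesis unfolding lborel_prod .
qed

section \<open>Gaussians and the three regimes\<close>

definition qgauss :: "real \<Rightarrow> quat \<Rightarrow> real \<times> real \<Rightarrow> quat" where
  "qgauss a C x = exp (- a * (norm x)\<^sup>2) *\<^sub>R C"

lemma borel_measurable_qgauss: "qgauss a C \<in> borel_measurable borel"
  unfolding qgauss_def[abs_def] by (intro borel_measurable_continuous_onI continuous_intros)

lemma gauss_dominated_qgauss: "gauss_dominated a (qgauss a C)"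
  unfolding gauss_dominated_def
  by (intro conjI borel_measurable_qgauss exI[of _ "\<lambda>_. 0"] exI[of _ "norm C"]) (auto simp: qgauss_def)

text \<open>The integrand factors as \<open>h qi\<close> times \<open>C\<close> times
  \<open>h qj\<close>, one variable in each outer factor. The sine parts integrate to zero by
  oddness, so both outer integrals are real and commute with \<open>C\<close>.\<close>

lemma qft_qgauss:
  assumes a: "a > 0"
  shows "qft (qgauss a C) \<xi> = (pi / a * exp (- (pi\<^sup>2 / a * (norm \<xi>)\<^sup>2))) *\<^sub>R C"
proof -
  define E where "E s = sqrt (pi / a) * exp (- (pi\<^sup>2 * s\<^sup>2 / a))" for s
  define h where "h u s t = exp (- a * t\<^sup>2) *\<^sub>R exp (- ((2 * pi * s * t) *\<^sub>R u))" for s t and u :: quat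
  have "has_bochner_integral lborel (\<lambda>t. (exp (- a * t\<^sup>2) * cos (2 * pi * s * t)) *\<^sub>R 1 - (exp (- a * t\<^sup>2) * sin (2 * pi * s * t)) *\<^sub>R u)
      (E s *\<^sub>R 1 - 0 *\<^sub>R u)" for s and u :: quat
    unfolding E_def
    by (intro has_bochner_integral_diff has_bochner_integral_scaleR_left gaussian_cos_integral[OF a] gaussian_sin_integral[OF a])
  then have h: "has_bochner_integral lborel (h qi s) (E s *\<^sub>R 1)" "has_bochner_integral lborel (h qj s) (E s *\<^sub>R 1)" for s
    unfolding h_def[abs_def] exp_qi_scaleR exp_qj_scaleR by (simp_all add: scaleR_diff_right)
  have kernel: "qft_kernel \<xi> x (qgauss a C x) = h qi (fst \<xi>) (fst x) * C * h qj (snd \<xi>) (snd x)" for x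
  proof -
    have "exp (- a * (norm x)\<^sup>2) = exp (- a * (fst x)\<^sup>2) * exp (- a * (snd x)\<^sup>2)"
      by (simp add: norm_prod_power2 mult_exp_exp distrib_left)
    then show ?thesis by (simp add: qft_kernel_def qgauss_def h_def)
  qed
  have int: "integrable lborel (\<lambda>x. qft_kernel \<xi> x (qgauss a C x))"
    by (intro integrable_qft_kernel gauss_dominated_integrable[OF gauss_dominated_qgauss a])
  then have int': "integrable (lborel \<Otimes>\<^sub>M lborel) (\<lambda>x. qft_kernel \<xi> x (qgauss a C x))"
    by (simp add: lborel_prod)
  have "qft (qgauss a C) \<xi> = (\<integral>x. qft_kernel \<xi> x (qgauss a C x) \<partial>(lborel \<Otimes>\<^sub>M lborel))"
    by (simp add: qft_lborel[OF borel_measurable_qgauss] lborel_prod)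
  also have "\<dots> = (\<integral>s. \<integral>t. qft_kernel \<xi> (s, t) (qgauss a C (s, t)) \<partial>lborel \<partial>lborel)"
    by (rule lborel_pair.integral_fst'[OF int', symmetric])
  also have "\<dots> = (\<integral>s. \<integral>t. h qi (fst \<xi>) s * C * h qj (snd \<xi>) t \<partial>lborel \<partial>lborel)"
    by (simp only: kernel fst_conv snd_conv)
  also have "\<dots> = (\<integral>s. h qi (fst \<xi>) s * C * (E (snd \<xi>) *\<^sub>R 1) \<partial>lborel)"
    using has_bochner_integral_mult_right[OF h(2)] has_bochner_integral_integral_eq
    by (intro Bochner_Integration.integral_cong refl) blast
  also have "\<dots> = E (fst \<xi>) *\<^sub>R 1 * C * (E (snd \<xi>) *\<^sub>R 1)"
    by (intro has_bochner_integral_integral_eq has_bochner_integral_mult_left h)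
  also have "\<dots> = (E (fst \<xi>) * E (snd \<xi>)) *\<^sub>R C" by simp
  also have "E (fst \<xi>) * E (snd \<xi>) = (sqrt (pi / a) * sqrt (pi / a)) * exp (- (pi\<^sup>2 / a * (norm \<xi>)\<^sup>2))"
  proof -
    have "exp (- (pi\<^sup>2 / a * (norm \<xi>)\<^sup>2)) = exp (- (pi\<^sup>2 * (fst \<xi>)\<^sup>2 / a)) * exp (- (pi\<^sup>2 * (snd \<xi>)\<^sup>2 / a))"
      by (simp add: norm_prod_power2 mult_exp_exp distrib_left add_divide_distrib)
    then show ?thesis unfolding E_def by (simp only: mult_ac)
  qed
  also have "sqrt (pi / a) * sqrt (pi / a) = pi / a" using a by simp
  finally show ?thesis .
qed

lemma condition_B_cong: "qft f = qft g \<Longrightarrow> condition_B b f \<longleftrightarrow> condition_B b g"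
  by (simp add: condition_B_def)

text \<open>Multiplying a decomposition by \<open>exp ((a' - a) * |x|^2)\<close>, which is at most
  1, keeps both summands in their spaces.\<close>

lemma condition_A_mono:
  assumes A: "condition_A a f" and le: "a' \<le> a"
  shows "condition_A a' f"
proof -
  obtain f1 f2 M where f1: "f1 \<in> borel_measurable lebesgue" "integrable lebesgue (\<lambda>x. norm (f1 x))"
    and f2: "f2 \<in> borel_measurable lebesgue" "AE x in lebesgue. norm (f2 x) \<le> M"
    and f: "(\<lambda>x. exp (a * (norm x)\<^sup>2) *\<^sub>R f x) = (\<lambda>x. f1 x + f2 x)"
    using A unfolding condition_A_def L1_plus_Linf_quat_def L1_quat_def Linf_quat_def by blast
  define c where "c x = exp ((a' - a) * (norm x)\<^sup>2)" for x :: "real \<times> real"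
  have c: "0 \<le> c x" "c x \<le> 1" for x
    using le by (auto simp: c_def mult_nonpos_nonneg)
  have "c \<in> borel_measurable borel"
    unfolding c_def[abs_def] by (intro borel_measurable_continuous_onI continuous_intros)
  then have [measurable]: "c \<in> borel_measurable lebesgue" by (intro measurable_completion) simp
  note [measurable] = f1(1) f2(1)
  have shrink: "norm (c x *\<^sub>R q) \<le> norm q" for x and q :: quat
    using c[of x] by (simp add: mult_left_le_one_le)
  have "exp (a' * (norm x)\<^sup>2) *\<^sub>R f x = c x *\<^sub>R f1 x + c x *\<^sub>R f2 x" for x
  proof -
    have "exp (a' * (norm x)\<^sup>2) *\<^sub>R f x = c x *\<^sub>R (exp (a * (norm x)\<^sup>2) *\<^sub>R f x)"
      by (simp add: c_def mult_exp_exp left_diff_distrib)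
    also have "\<dots> = c x *\<^sub>R (f1 x + f2 x)" using fun_cong[OF f, of x] by (simp only:)
    finally show ?thesis by (simp add: scaleR_add_right)
  qed
  moreover have "(\<lambda>x. c x *\<^sub>R f1 x) \<in> L1_quat"
  proof -
    have "integrable lebesgue (\<lambda>x. norm (c x *\<^sub>R f1 x))"
      by (rule Bochner_Integration.integrable_bound[OF f1(2)]) (use shrink in auto)
    then show ?thesis by (simp add: L1_quat_def)
  qed
  moreover have "(\<lambda>x. c x *\<^sub>R f2 x) \<in> Linf_quat"
  proof -
    have "AE x in lebesgue. norm (c x *\<^sub>R f2 x) \<le> M"
      using f2(2) by eventually_elim (use shrink order.trans in blast)
    then show ?thesis unfolding Linf_quat_def by auto
  qed
  ultimately show ?thesis
    unfolding condition_A_def L1_plus_Linf_quat_def by auto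
qed

lemma condition_B_mono:
  assumes B: "condition_B b f" and le: "b' \<le> b"
  shows "condition_B b' f"
proof -
  obtain \<rho> where \<rho>: "\<rho> > 0"
    and fin: "(\<integral>\<^sup>+ y. ennreal (log_plus (norm (exp (b * (norm y)\<^sup>2) *\<^sub>R qft f y) / \<rho>)) \<partial>lebesgue) < \<infinity>"
    using B unfolding condition_B_def by blast
  have "(\<integral>\<^sup>+ y. ennreal (log_plus (norm (exp (b' * (norm y)\<^sup>2) *\<^sub>R qft f y) / \<rho>)) \<partial>lebesgue)
      \<le> (\<integral>\<^sup>+ y. ennreal (log_plus (norm (exp (b * (norm y)\<^sup>2) *\<^sub>R qft f y) / \<rho>)) \<partial>lebesgue)"
    using \<rho> le by (intro nn_integral_mono ennreal_leI log_plus_mono divide_right_mono)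
      (auto intro!: mult_right_mono)
  with fin \<rho> show ?thesis unfolding condition_B_def by (meson le_less_trans)
qed

lemma gaussian_if_conditions:
  assumes a: "a > 0" and f: "f \<in> borel_measurable lebesgue"
    and A: "condition_A a f" and B: "condition_B (pi\<^sup>2 / a) f"
  shows "\<exists>C. AE x in lebesgue. f x = qgauss a C x"
proof -
  obtain f' where dom: "gauss_dominated a f'" and ae: "AE x in lebesgue. f x = f' x"
    using condition_A_gauss_dominated[OF A] by blast
  have f': "f' \<in> borel_measurable borel" using dom by (simp add: gauss_dominated_def)
  have int: "integrable lborel f'" using gauss_dominated_integrable[OF dom a] .
  have "condition_B (pi\<^sup>2 / a) f'"
    using B condition_B_cong[OF qft_cong_AE[OF f f' ae]] by blast
  note qft = qft_eq_gaussian[OF a dom this]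
  \<comment> \<open>The transform of \<open>qgauss a C\<close> at the origin is
    \<open>(pi / a) *\<^sub>R C\<close>; this \<open>C\<close> makes it agree with that of
    \<open>f'\<close>.\<close>
  define C where "C = (a / pi) *\<^sub>R qft f' 0"
  have intg: "integrable lborel (qgauss a C)"
    by (rule gauss_dominated_integrable[OF gauss_dominated_qgauss a])
  have "AE x in lborel. f' x - qgauss a C x = 0"
  proof (rule AE_zero_if_qft_zero)
    show "integrable lborel (\<lambda>x. f' x - qgauss a C x)" using int intg by simp
    fix \<xi>
    have "qft (\<lambda>x. f' x - qgauss a C x) \<xi> = qft f' \<xi> - qft (qgauss a C) \<xi>"
    proof -
      have "qft_kernel \<xi> x (f' x - qgauss a C x) = qft_kernel \<xi> x (f' x) - qft_kernel \<xi> x (qgauss a C x)" for x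
        by (simp add: qft_kernel_def left_diff_distrib right_diff_distrib)
      then show ?thesis
        using integrable_qft_kernel[OF int, of \<xi>] integrable_qft_kernel[OF intg, of \<xi>] f' borel_measurable_qgauss[of a C]
        by (simp add: qft_lborel)
    qed
    also have "\<dots> = 0"
      unfolding qft_qgauss[OF a] qft[of \<xi>] C_def using a by simp
    finally show "qft (\<lambda>x. f' x - qgauss a C x) \<xi> = 0" .
  qed
  then have "AE x in lebesgue. f' x - qgauss a C x = 0" by (rule AE_completion)
  with ae have "AE x in lebesgue. f x = qgauss a C x"
    by eventually_elim simp
  then show ?thesis by blast
qed

lemma qgauss_AE_eq:
  assumes "AE x in lebesgue. qgauss a C x = qgauss b D x"
  shows "qgauss a C = qgauss b D"
proof -
  have m: "{x \<in> space lborel. qgauss a C x \<noteq> qgauss b D x} \<in> sets lborel"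
    using borel_measurable_qgauss[of a C] borel_measurable_qgauss[of b D] by simp
  have "AE x in lborel. qgauss a C x = qgauss b D x"
    using assms by (simp add: AE_completion_iff)
  then have "AE x in lborel. x \<in> {x. qgauss a C x = qgauss b D x}" by simp
  moreover have "closed {x. qgauss a C x = qgauss b D x}"
    unfolding qgauss_def by (intro closed_Collect_eq continuous_intros)
  ultimately have "{x. qgauss a C x = qgauss b D x} = UNIV"
    by (intro closed_full_measure_UNIV)
  then show ?thesis by blast
qed

lemma qgauss_eq_imp:
  assumes "qgauss a C = qgauss b D"
  shows "C = D" and "a \<noteq> b \<Longrightarrow> C = 0"
proof -
  show "C = D" using fun_cong[OF assms, of 0] by (simp add: qgauss_def)
  then show "C = 0" if "a \<noteq> b"
    using fun_cong[OF assms, of "(1, 0)"] that by (simp add: qgauss_def)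
qed

lemma condition_A_qgauss: "condition_A a (qgauss a C)"
  unfolding condition_A_def L1_plus_Linf_quat_def mem_Collect_eq
proof (intro exI conjI)
  show "(\<lambda>x. exp (a * (norm x)\<^sup>2) *\<^sub>R qgauss a C x) = (\<lambda>x. 0 + C)"
    by (simp add: qgauss_def mult_exp_exp)
  show "(\<lambda>x. 0) \<in> L1_quat" by (simp add: L1_quat_def)
  show "(\<lambda>x. C) \<in> Linf_quat" by (auto simp: Linf_quat_def)
qed

lemma condition_B_qgauss:
  assumes a: "a > 0" and b: "b \<le> pi\<^sup>2 / a"
  shows "condition_B b (qgauss a C)"
proof -
  \<comment> \<open>The threshold exceeds every value of the weighted transform, so
    \<open>log_plus\<close> vanishes identically; the summand 1 keeps it positive when
    \<open>C = 0\<close>.\<close>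
  define \<rho> where "\<rho> = pi / a * norm C + 1"
  have \<rho>: "\<rho> > 0" unfolding \<rho>_def using a by (intro add_nonneg_pos) auto
  have "log_plus (norm (exp (b * (norm y)\<^sup>2) *\<^sub>R qft (qgauss a C) y) / \<rho>) = 0" for y
  proof -
    have "norm (exp (b * (norm y)\<^sup>2) *\<^sub>R qft (qgauss a C) y)
      = exp ((b - pi\<^sup>2 / a) * (norm y)\<^sup>2) * (pi / a * norm C)"
      unfolding qft_qgauss[OF a] using a
      by (simp add: abs_mult mult_exp_exp left_diff_distrib flip: mult.assoc)
    also have "\<dots> \<le> 1 * (pi / a * norm C)"
      using a b by (intro mult_right_mono) (auto simp: mult_nonpos_nonneg)
    finally have "norm (exp (b * (norm y)\<^sup>2) *\<^sub>R qft (qgauss a C) y) / \<rho> \<le> 1"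
      using \<rho> by (simp add: \<rho>_def)
    then show ?thesis by (simp add: log_plus_def)
  qed
  then show ?thesis
    unfolding condition_B_def using \<rho> by (intro exI[of _ \<rho>]) simp
qed

theorem theorem4p2:
  fixes \<alpha> \<beta> :: real
  assumes "\<alpha> > 0" and "\<beta> > 0"
  shows "(\<alpha> * \<beta> > pi\<^sup>2 \<longrightarrow>
            (\<forall>f \<in> borel_measurable lebesgue. condition_A \<alpha> f \<and> condition_B \<beta> f \<longrightarrow>
               (AE x in lebesgue. f x = 0))) \<and>
         (\<alpha> * \<beta> = pi\<^sup>2 \<longrightarrow>
            (\<forall>f \<in> borel_measurable lebesgue. condition_A \<alpha> f \<and> condition_B \<beta> f \<longrightarrow>
               (\<exists>C :: quat. AE x in lebesgue. f x = exp (- \<alpha> * (norm x)\<^sup>2) *\<^sub>R C))) \<and>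
         (\<alpha> * \<beta> < pi\<^sup>2 \<longrightarrow>
            (\<exists>S. infinite S \<and>
               (\<forall>f \<in> S. f \<in> borel_measurable lebesgue \<and> condition_A \<alpha> f \<and> condition_B \<beta> f) \<and>
               pairwise (\<lambda>f g. \<not> (AE x in lebesgue. f x = g x)) S))"
proof (intro conjI impI ballI; (elim conjE)?)
  fix f :: "real \<times> real \<Rightarrow> quat"
  assume gt: "pi\<^sup>2 < \<alpha> * \<beta>" and f: "f \<in> borel_measurable lebesgue"
    and A: "condition_A \<alpha> f" and B: "condition_B \<beta> f"
  \<comment> \<open>The exponent critical for \<open>\<beta>\<close>, strictly below
    \<open>\<alpha>\<close>. Keeping \<open>\<alpha>\<close> and lowering \<open>\<beta>\<close> to
    \<open>pi^2 / \<alpha>\<close> gives the other critical pair, and Gaussians of widths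
    \<open>\<alpha>'\<close> and \<open>\<alpha>\<close> agree only when they vanish.\<close>
  define \<alpha>' where "\<alpha>' = pi\<^sup>2 / \<beta>"
  have \<alpha>': "\<alpha>' > 0" "\<alpha>' < \<alpha>" "pi\<^sup>2 / \<alpha>' = \<beta>"
    using assms gt by (auto simp: \<alpha>'_def field_simps)
  obtain C where C: "AE x in lebesgue. f x = qgauss \<alpha>' C x"
    using gaussian_if_conditions[OF \<alpha>'(1) f condition_A_mono[OF A]] B \<alpha>' by auto
  have "condition_B (pi\<^sup>2 / \<alpha>) f"
    using assms gt by (intro condition_B_mono[OF B]) (simp add: field_simps)
  then obtain D where D: "AE x in lebesgue. f x = qgauss \<alpha> D x"
    using gaussian_if_conditions[OF assms(1) f A] by auto
  have "AE x in lebesgue. qgauss \<alpha>' C x = qgauss \<alpha> D x"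
    using C D by eventually_elim simp
  then have "C = 0" using qgauss_AE_eq qgauss_eq_imp(2) \<alpha>'(2) by blast
  with C show "AE x in lebesgue. f x = 0" by (simp add: qgauss_def)
next
  fix f :: "real \<times> real \<Rightarrow> quat"
  assume eq: "\<alpha> * \<beta> = pi\<^sup>2" and f: "f \<in> borel_measurable lebesgue"
    and A: "condition_A \<alpha> f" and B: "condition_B \<beta> f"
  have "\<beta> = pi\<^sup>2 / \<alpha>" using assms eq by (simp add: field_simps)
  then show "\<exists>C. AE x in lebesgue. f x = exp (- \<alpha> * (norm x)\<^sup>2) *\<^sub>R C"
    using gaussian_if_conditions[OF assms(1) f A] B unfolding qgauss_def by auto
next
  assume lt: "\<alpha> * \<beta> < pi\<^sup>2"
  \<comment> \<open>Integer amplitudes at the fixed width \<open>\<alpha>\<close>: the weighted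
    function in (A) is constant, and (B) holds because \<open>\<beta> < pi^2 / \<alpha>\<close>.
    Distinct continuous functions are not almost everywhere equal.\<close>
  define S where "S = range (\<lambda>n::nat. qgauss \<alpha> (of_nat n))"
  show "\<exists>S. infinite S \<and>
      (\<forall>f \<in> S. f \<in> borel_measurable lebesgue \<and> condition_A \<alpha> f \<and> condition_B \<beta> f) \<and>
      pairwise (\<lambda>f g. \<not> (AE x in lebesgue. f x = g x)) S"
  proof (intro exI[of _ S] conjI ballI)
    have "inj (\<lambda>n::nat. qgauss \<alpha> (of_nat n))"
      using qgauss_eq_imp(1) by (intro injI) (metis of_nat_eq_iff)
    then show "infinite S" unfolding S_def by (rule range_inj_infinite)
    show "pairwise (\<lambda>f g. \<not> (AE x in lebesgue. f x = g x)) S"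
      unfolding pairwise_def S_def using qgauss_AE_eq by blast
    fix f assume "f \<in> S"
    then obtain n :: nat where f: "f = qgauss \<alpha> (of_nat n)" by (auto simp: S_def)
    show "f \<in> borel_measurable lebesgue"
      unfolding f using borel_measurable_qgauss by (intro measurable_completion) simp
    show "condition_A \<alpha> f" unfolding f by (rule condition_A_qgauss)
    show "condition_B \<beta> f"
      unfolding f using assms lt by (intro condition_B_qgauss) (auto simp: field_simps)
  qed
qed

end
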